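(* Let $\alpha$ be a composition of $n$ and let $E\in\mathcal{E}(\alpha)$ be an equivalence class of standard reverse composition tableaux of shape $\alpha$, with source tableau $\tau^{\rightarrow}_E$ and sink tableau $\tau^{\leftarrow}_E$. Then $$P_{\mathbf{S}_{\alpha,E}}=P_{D_{\mathrm{comp}(\mathrm{Des}(\tau^{\rightarrow}_E)^{\mathrm c});\ \underline{\mathsf{read}}(\tau^{\leftarrow}_E)}},$$ where $\mathrm{Des}(\tau^{\rightarrow}_E)^{\mathrm c}=[n-1]\setminus\mathrm{Des}(\tau^{\rightarrow}_E)$.
   Context: Permutations in $\mathfrak{S}_n$ are written in one-line notation (words in $1,\dots,n$ without repetition are regarded as permutations) and composed as functions; $s_i=(i\ i{+}1)$; $\ell$ is the length; $\mathrm{Des}_L(\sigma)=\{i\in[n-1]:\ell(s_i\sigma)<\ell(\sigma)\}$. The left weak Bruhat order $\preceq_L$ has covers $\sigma\prec s_i\sigma$ when $\ell(s_i\sigma)>\ell(\sigma)$; $[\sigma,\rho]_L$ denotes an interval. $w_0$ is the longest element of $\mathfrak{S}_n$. For $\beta\models n$, $\mathrm{set}(\beta)=\{\beta_1,\beta_1+\beta_2,\dots,\beta_1+\cdots+\beta_{\ell(\beta)-1}\}\subseteq[n-1]$, $\mathrm{comp}$ is the inverse bijection (subsets of $[n-1]$ to compositions of $n$), $\mathrm{set}(\beta^{\mathrm c})=[n-1]\setminus\mathrm{set}(\beta)$, and $w_0(\beta)$ is the longest element of the parabolic subgroup generated by $\{s_i:i\in\mathrm{set}(\beta)\}$. For a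 poset $P$ on $[n]$, $\Sigma_R(P)=\{\sigma\in\mathfrak{S}_n:\sigma^{-1}(i)<\sigma^{-1}(j)\text{ whenever }i\prec_P j\}$. For $\sigma\preceq_L\rho$ there is a unique poset $P$ on $[n]$ with $\Sigma_R(P)=\{w_0\gamma^{-1}:\gamma\in[\sigma,\rho]_L\}$. The composition diagram $\mathtt{cd}(\alpha)$ is the left-justified array whose $i$th row from the top has $\alpha_i$ boxes; $(i,j)$ is the box in row $i$ from the top, column $j$ from the left. A standard reverse composition tableau (SRCT) of shape $\alpha$ is a bijective filling $\tau$ of $\mathtt{cd}(\alpha)$ with $1,\dots,n$ such that rows decrease left to right, the first column increases top to bottom, and if $i<j$ and $\tau_{i,k}>\tau_{j,k+1}$ then $(i,k+1)\in\mathtt{cd}(\alpha)$ and $\tau_{i,k+1}>\tau_{j,k+1}$. $\mathrm{Des}(\tau)$ is the set of $i\in[n-1]$ such that $i+1$ appears weakly right of $i$ in $\tau$. Two SRCTs are equivalent if, for each column, their entries in that column read from top to bottom are in the same relative order; $\mathcal{E}(\alpha)$ is the set of equivalence classes. An SRCT is a source tableau if for every $i\notin\mathrm{Des}(\tau)$, $i\neq n$, $i+1$ lies immediately left of $i$; it is a sink tableau if for every $i\in\mathrm{Des}(\tau)$ either $i$ and $i+1$ are in the same column or they are in adjacent columns with $i+1$ positioned lower-right of $i$. Each class $E$ contains a unique source tableau $\tau^{\rightarrow}_E$ and a unique sink tableau $\tau^{\leftarrow}_E$. Let $\mathrm{Des}(\tau^{\rightarrow}_E)=\{d_1<\cdots<d_m\}$,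 $d_0=0$, $d_{m+1}=n$, and let $\mathtt{H}_j$ ($1\le j\le m+1$) be the set of boxes (a horizontal strip) with entries $d_{j-1}+1,\dots,d_j$ in $\tau^{\rightarrow}_E$. For $\tau\in E$, $\underline{\mathsf{read}}(\tau)$ is the concatenation $\mathrm{w}^{(1)}(\tau)\,\mathrm{w}^{(2)}(\tau)\cdots\mathrm{w}^{(m+1)}(\tau)$, where $\mathrm{w}^{(j)}(\tau)$ is the word of entries of $\tau$ in $\mathtt{H}_j$ read from left to right. $P_{\mathbf{S}_{\alpha,E}}$ is the unique poset on $[n]$ with $\Sigma_R(P_{\mathbf{S}_{\alpha,E}})=\{w_0\gamma^{-1}:\gamma\in[\underline{\mathsf{read}}(\tau^{\rightarrow}_E),\underline{\mathsf{read}}(\tau^{\leftarrow}_E)]_L\}$ (the interval comes from the indecomposable summand $\mathbf{S}_{\alpha,E}$ of the $0$-Hecke module of the quasisymmetric Schur function). For an $n$-element $D\subseteq\mathbb{N}^2$ ($\mathbb{N}=\{1,2,\dots\}$) whose sets of first and second coordinates are initial segments $[l]$, $[k]$ of $\mathbb{N}$, view $(x,y)\in D$ as a box in column $x$ (from the left) and row $y$ (from the bottom). Let $(x_i,y_i)$ be the $i$th element of $D$ enumerated along rows from left to right, starting with the uppermost row; $P_D$ is the poset on $[n]$ with $i\preceq_{P_D}j$ iff $x_i\le x_j$ and $y_i\le y_j$. For $\beta\models n$ and $\rho\in\mathfrak{S}_n$ with $w_0(\beta)\preceq_L\rho$, $D_{\beta;\rho}$ is defined as follows. Let $\mathrm{set}(\beta^{\mathrm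 c})=\{z_1<\cdots<z_l\}$, $z_0=0$, $z_{l+1}=n$, and $R_j=\{\rho(r):z_{j-1}+1\le r\le z_j\}$ for $1\le j\le l+1$. Let $\mathrm{Des}_L(\rho)=\{k_1<\cdots<k_e\}$, $k_0=0$, $k_{e+1}=n$, and $C_i=\{c:k_{i-1}+1\le c\le k_i\}$ for $1\le i\le e+1$. Then $D_{\beta;\rho}=\{(i,j)\in\mathbb{N}^2:R_j\cap C_i\ne\emptyset\}$. *)

theory Defs
  imports Main "HOL-Library.FuncSet" "HOL-Combinatorics.Combinatorics"
begin

section \<open>Symmetric group and left weak order\<close>

text \<open>
  A permutation in the symmetric group on \<open>[n]\<close> is a function \<open>\<sigma>\<close> with \<open>\<sigma> permutes {1..n}\<close>.
\<close>

definition perm_of_word :: "nat list \<Rightarrow> nat \<Rightarrow> nat" where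
  "perm_of_word w i = (if 1 \<le> i \<and> i \<le> length w then w ! (i - 1) else i)"

definition simple_refl :: "nat \<Rightarrow> nat \<Rightarrow> nat" where
  "simple_refl i = transpose i (Suc i)"

definition coxeter_length :: "nat \<Rightarrow> (nat \<Rightarrow> nat) \<Rightarrow> nat" where
  "coxeter_length n \<sigma> =
     (LEAST k. \<exists>js. length js = k \<and> set js \<subseteq> {1..<n} \<and>
        \<sigma> = foldr (\<lambda>i f. simple_refl i \<circ> f) js id)"

definition left_descents :: "nat \<Rightarrow> (nat \<Rightarrow> nat) \<Rightarrow> nat set" where
  "left_descents n \<sigma> =
     {i \<in> {1..<n}. coxeter_length n (simple_refl i \<circ> \<sigma>) < coxeter_length n \<sigma>}"

definition left_weak_cover :: "nat \<Rightarrow> (nat \<Rightarrow> nat) \<Rightarrow> (nat \<Rightarrow> nat) \<Rightarrow> bool" where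
  "left_weak_cover n \<sigma> \<rho> \<longleftrightarrow> \<sigma> permutes {1..n} \<and>
     (\<exists>i\<in>{1..<n}. \<rho> = simple_refl i \<circ> \<sigma> \<and> coxeter_length n \<sigma> < coxeter_length n \<rho>)"

definition left_weak_le :: "nat \<Rightarrow> (nat \<Rightarrow> nat) \<Rightarrow> (nat \<Rightarrow> nat) \<Rightarrow> bool" where
  "left_weak_le n \<sigma> \<rho> \<longleftrightarrow>
     \<sigma> permutes {1..n} \<and> \<rho> permutes {1..n} \<and> (left_weak_cover n)\<^sup>*\<^sup>* \<sigma> \<rho>"

definition left_weak_interval :: "nat \<Rightarrow> (nat \<Rightarrow> nat) \<Rightarrow> (nat \<Rightarrow> nat) \<Rightarrow> (nat \<Rightarrow> nat) set" where
  "left_weak_interval n \<sigma> \<rho> = {\<gamma>. left_weak_le n \<sigma> \<gamma> \<and> left_weak_le n \<gamma> \<rho>}"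

definition longest_perm :: "nat \<Rightarrow> nat \<Rightarrow> nat" where
  "longest_perm n = (ARG_MAX (coxeter_length n) \<sigma>. \<sigma> permutes {1..n})"


section \<open>Compositions\<close>

definition compositions :: "nat \<Rightarrow> nat list set" where
  "compositions n = {\<beta>. (\<forall>b\<in>set \<beta>. 0 < b) \<and> sum_list \<beta> = n}"

definition set_of_comp :: "nat list \<Rightarrow> nat set" where
  "set_of_comp \<beta> = {sum_list (take i \<beta>) | i. 1 \<le> i \<and> i < length \<beta>}"

definition comp_of_set :: "nat \<Rightarrow> nat set \<Rightarrow> nat list" where
  "comp_of_set n = the_inv_into (compositions n) set_of_comp"

definition comp_complement :: "nat list \<Rightarrow> nat list" where
  "comp_complement \<beta> = comp_of_set (sum_list \<beta>) ({1..<sum_list \<beta>} - set_of_comp \<beta>)"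

text \<open>
  For \<open>S = {s\<^sub>1 < \<dots> < s\<^sub>m} \<subseteq> [n-1]\<close>, \<open>s\<^sub>0 = 0\<close> and \<open>s\<^sub>m\<^sub>+\<^sub>1 = n\<close>, \<open>block n S j\<close> is
  \<open>{s\<^sub>j\<^sub>-\<^sub>1 + 1, \<dots>, s\<^sub>j}\<close>, for \<open>1 \<le> j \<le> m + 1\<close>.
\<close>
definition block :: "nat \<Rightarrow> nat set \<Rightarrow> nat \<Rightarrow> nat set" where
  "block n S j = (let s = 0 # sorted_list_of_set S @ [n] in {s ! (j - 1) + 1 .. s ! j})"


section \<open>Posets and intervals\<close>

text \<open>A poset on \<open>[n]\<close> is given by its reflexive order relation.\<close>

definition Sigma_R :: "nat \<Rightarrow> (nat \<times> nat) set \<Rightarrow> (nat \<Rightarrow> nat) set" where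
  "Sigma_R n P = {\<sigma>. \<sigma> permutes {1..n} \<and>
     (\<forall>i j. (i, j) \<in> P \<and> i \<noteq> j \<longrightarrow> inv \<sigma> i < inv \<sigma> j)}"

definition interval_poset :: "nat \<Rightarrow> (nat \<Rightarrow> nat) \<Rightarrow> (nat \<Rightarrow> nat) \<Rightarrow> (nat \<times> nat) set" where
  "interval_poset n \<sigma> \<rho> = (THE P. partial_order_on {1..n} P \<and>
     Sigma_R n P = {longest_perm n \<circ> inv \<gamma> | \<gamma>. \<gamma> \<in> left_weak_interval n \<sigma> \<rho>})"


section \<open>Standard reverse composition tableaux\<close>

text \<open>Boxes of a composition diagram are pairs (row from the top, column from the left).\<close>

definition comp_diagram :: "nat list \<Rightarrow> (nat \<times> nat) set" where
  "comp_diagram \<alpha> = {(i, j). 1 \<le> i \<and> i \<le> length \<alpha> \<and> 1 \<le> j \<and> j \<le> \<alpha> ! (i - 1)}"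

definition SRCT :: "nat list \<Rightarrow> (nat \<times> nat \<Rightarrow> nat) set" where
  "SRCT \<alpha> = {\<tau>. \<tau> \<in> extensional (comp_diagram \<alpha>) \<and>
     bij_betw \<tau> (comp_diagram \<alpha>) {1..sum_list \<alpha>} \<and>
     (\<forall>i j j'. (i, j) \<in> comp_diagram \<alpha> \<and> (i, j') \<in> comp_diagram \<alpha> \<and> j < j' \<longrightarrow>
        \<tau> (i, j') < \<tau> (i, j)) \<and>
     (\<forall>i i'. (i, 1) \<in> comp_diagram \<alpha> \<and> (i', 1) \<in> comp_diagram \<alpha> \<and> i < i' \<longrightarrow>
        \<tau> (i, 1) < \<tau> (i', 1)) \<and>
     (\<forall>i j k. i < j \<and> (i, k) \<in> comp_diagram \<alpha> \<and> (j, k + 1) \<in> comp_diagram \<alpha> \<and>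
        \<tau> (j, k + 1) < \<tau> (i, k) \<longrightarrow>
        (i, k + 1) \<in> comp_diagram \<alpha> \<and> \<tau> (j, k + 1) < \<tau> (i, k + 1))}"

definition box_of :: "nat list \<Rightarrow> (nat \<times> nat \<Rightarrow> nat) \<Rightarrow> nat \<Rightarrow> nat \<times> nat" where
  "box_of \<alpha> \<tau> = the_inv_into (comp_diagram \<alpha>) \<tau>"

definition row_of :: "nat list \<Rightarrow> (nat \<times> nat \<Rightarrow> nat) \<Rightarrow> nat \<Rightarrow> nat" where
  "row_of \<alpha> \<tau> i = fst (box_of \<alpha> \<tau> i)"

definition col_of :: "nat list \<Rightarrow> (nat \<times> nat \<Rightarrow> nat) \<Rightarrow> nat \<Rightarrow> nat" where
  "col_of \<alpha> \<tau> i = snd (box_of \<alpha> \<tau> i)"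

definition tab_descents :: "nat list \<Rightarrow> (nat \<times> nat \<Rightarrow> nat) \<Rightarrow> nat set" where
  "tab_descents \<alpha> \<tau> = {i \<in> {1..<sum_list \<alpha>}. col_of \<alpha> \<tau> i \<le> col_of \<alpha> \<tau> (i + 1)}"

definition SRCT_equiv :: "nat list \<Rightarrow> ((nat \<times> nat \<Rightarrow> nat) \<times> (nat \<times> nat \<Rightarrow> nat)) set" where
  "SRCT_equiv \<alpha> = {(\<tau>, \<tau>'). \<tau> \<in> SRCT \<alpha> \<and> \<tau>' \<in> SRCT \<alpha> \<and>
     (\<forall>k i i'. (i, k) \<in> comp_diagram \<alpha> \<and> (i', k) \<in> comp_diagram \<alpha> \<longrightarrow>
        (\<tau> (i, k) < \<tau> (i', k) \<longleftrightarrow> \<tau>' (i, k) < \<tau>' (i', k)))}"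

definition SRCT_classes :: "nat list \<Rightarrow> (nat \<times> nat \<Rightarrow> nat) set set" where
  "SRCT_classes \<alpha> = SRCT \<alpha> // SRCT_equiv \<alpha>"

definition source_tableau :: "nat list \<Rightarrow> (nat \<times> nat \<Rightarrow> nat) \<Rightarrow> bool" where
  "source_tableau \<alpha> \<tau> \<longleftrightarrow> \<tau> \<in> SRCT \<alpha> \<and>
     (\<forall>i\<in>{1..sum_list \<alpha>}. i \<notin> tab_descents \<alpha> \<tau> \<and> i \<noteq> sum_list \<alpha> \<longrightarrow>
        row_of \<alpha> \<tau> (i + 1) = row_of \<alpha> \<tau> i \<and> col_of \<alpha> \<tau> (i + 1) + 1 = col_of \<alpha> \<tau> i)"

definition sink_tableau :: "nat list \<Rightarrow> (nat \<times> nat \<Rightarrow> nat) \<Rightarrow> bool" where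
  "sink_tableau \<alpha> \<tau> \<longleftrightarrow> \<tau> \<in> SRCT \<alpha> \<and>
     (\<forall>i\<in>tab_descents \<alpha> \<tau>.
        col_of \<alpha> \<tau> (i + 1) = col_of \<alpha> \<tau> i \<or>
        (col_of \<alpha> \<tau> (i + 1) = col_of \<alpha> \<tau> i + 1 \<and> row_of \<alpha> \<tau> i < row_of \<alpha> \<tau> (i + 1)))"

definition source_of :: "nat list \<Rightarrow> (nat \<times> nat \<Rightarrow> nat) set \<Rightarrow> nat \<times> nat \<Rightarrow> nat" where
  "source_of \<alpha> E = (THE \<tau>. \<tau> \<in> E \<and> source_tableau \<alpha> \<tau>)"

definition sink_of :: "nat list \<Rightarrow> (nat \<times> nat \<Rightarrow> nat) set \<Rightarrow> nat \<times> nat \<Rightarrow> nat" where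
  "sink_of \<alpha> E = (THE \<tau>. \<tau> \<in> E \<and> sink_tableau \<alpha> \<tau>)"


section \<open>Reading word and the poset of a class\<close>

definition strip :: "nat list \<Rightarrow> (nat \<times> nat \<Rightarrow> nat) set \<Rightarrow> nat \<Rightarrow> (nat \<times> nat) set" where
  "strip \<alpha> E j = {b \<in> comp_diagram \<alpha>.
     source_of \<alpha> E b \<in> block (sum_list \<alpha>) (tab_descents \<alpha> (source_of \<alpha> E)) j}"

text \<open>
  A horizontal strip \<open>H\<close> has at most one box in each column, so \<open>snd\<close> is injective on \<open>H\<close> and
  \<open>the_inv_into H snd c\<close> is the box of \<open>H\<close> in column \<open>c\<close>.
\<close>
definition strip_word :: "(nat \<times> nat) set \<Rightarrow> (nat \<times> nat \<Rightarrow> nat) \<Rightarrow> nat list" where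
  "strip_word H \<tau> = map (\<lambda>c. \<tau> (the_inv_into H snd c)) (sorted_list_of_set (snd ` H))"

definition read_word :: "nat list \<Rightarrow> (nat \<times> nat \<Rightarrow> nat) set \<Rightarrow> (nat \<times> nat \<Rightarrow> nat) \<Rightarrow> nat list" where
  "read_word \<alpha> E \<tau> = concat (map (\<lambda>j. strip_word (strip \<alpha> E j) \<tau>)
     [1..<card (tab_descents \<alpha> (source_of \<alpha> E)) + 2])"

definition read_perm :: "nat list \<Rightarrow> (nat \<times> nat \<Rightarrow> nat) set \<Rightarrow> (nat \<times> nat \<Rightarrow> nat) \<Rightarrow> nat \<Rightarrow> nat" where
  "read_perm \<alpha> E \<tau> = perm_of_word (read_word \<alpha> E \<tau>)"

definition class_poset :: "nat list \<Rightarrow> (nat \<times> nat \<Rightarrow> nat) set \<Rightarrow> (nat \<times> nat) set" where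
  "class_poset \<alpha> E = interval_poset (sum_list \<alpha>)
     (read_perm \<alpha> E (source_of \<alpha> E)) (read_perm \<alpha> E (sink_of \<alpha> E))"


section \<open>Posets of planar configurations\<close>

text \<open>
  Here a pair \<open>(x, y)\<close> is the box in column \<open>x\<close> from the left and row \<open>y\<close> from the bottom.
\<close>

definition row_enum :: "(nat \<times> nat) set \<Rightarrow> (nat \<times> nat) list" where
  "row_enum D = concat (map (\<lambda>y. map (\<lambda>x. (x, y)) (sorted_list_of_set {x. (x, y) \<in> D}))
     (rev (sorted_list_of_set (snd ` D))))"

definition diagram_poset :: "(nat \<times> nat) set \<Rightarrow> (nat \<times> nat) set" where
  "diagram_poset D = {(i, j). i \<in> {1..card D} \<and> j \<in> {1..card D} \<and>
     fst (row_enum D ! (i - 1)) \<le> fst (row_enum D ! (j - 1)) \<and>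
     snd (row_enum D ! (i - 1)) \<le> snd (row_enum D ! (j - 1))}"

text \<open>
  \<open>interval_diagram \<beta> \<rho>\<close> is of interest only when \<open>\<rho>\<close> lies above the longest element of the
  parabolic subgroup generated by the \<open>s\<^sub>i\<close> with \<open>i \<in> set_of_comp \<beta>\<close>; the defining formula is
  used for all \<open>\<beta>\<close> and \<open>\<rho>\<close>.
\<close>
definition interval_diagram :: "nat list \<Rightarrow> (nat \<Rightarrow> nat) \<Rightarrow> (nat \<times> nat) set" where
  "interval_diagram \<beta> \<rho> =
     (let n = sum_list \<beta>;
          Z = set_of_comp (comp_complement \<beta>);
          K = left_descents n \<rho>;
          R = (\<lambda>j. \<rho> ` block n Z j);
          C = (\<lambda>i. block n K i)
      in {(i, j). i \<in> {1..card K + 1} \<and> j \<in> {1..card Z + 1} \<and> R j \<inter> C i \<noteq> {}})"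

end

theory Submission
  imports Defs
begin

text \<open>
  In left weak order the interval \<open>[\<sigma>, \<rho>]\<close> consists of the \<open>\<gamma>\<close> whose set of inverted position pairs
  lies between those of \<open>\<sigma>\<close> and \<open>\<rho>\<close>. The word of the source tableau is decreasing on the blocks cut
  out by its descents and increasing across them, and a strip of the source tableau is a segment of
  a single row, so the word of every tableau of the class decreases on these blocks. For such \<open>\<rho>\<close>,
  place the position \<open>p\<close> in the row given by the block of \<open>p\<close> and the column given by the block of
  \<open>\<rho> p\<close>. Within a row \<open>\<rho>\<close> decreases, within a column it increases, so positions get distinct boxes,
  and the conditions on \<open>\<gamma>\<close> say precisely that \<open>\<gamma>\<close> is monotone for the product order on boxes.

  Source and sink exist and are unique because a class is the set of linear extensions of a poset on
  the boxes. It is generated by relations inside a column or between adjacent columns, and every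
  column is a chain. Hence a filling in which each descent \<open>i\<close> has the box of \<open>i\<close> below
  that of \<open>i + 1\<close> in this poset has every pair \<open>i < j\<close> with \<open>j\<close> weakly right of \<open>i\<close> forced, which determines it.
  A filling with fewest such pairs has this property. Reversing the columns turns sinks into sources.
\<close>

section \<open>Inversions and left weak order\<close>

text \<open>Recorded as pairs of positions: left multiplication by a simple reflection only
  exchanges two values, so along a cover of left weak order this set keeps its members and gains one
  pair.\<close>

definition inversions :: "nat \<Rightarrow> (nat \<Rightarrow> nat) \<Rightarrow> (nat \<times> nat) set" where
  "inversions n \<sigma> = {(p, q). p \<in> {1..n} \<and> q \<in> {1..n} \<and> p < q \<and> \<sigma> q < \<sigma> p}"

lemma finite_inversions: "finite (inversions n \<sigma>)"
  by (rule finite_subset[of _ "{1..n} \<times> {1..n}"]) (auto simp: inversions_def)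

section \<open>Left multiplication by a simple reflection\<close>

lemma permutes_simple_refl: "i \<in> {1..<n} \<Longrightarrow> simple_refl i permutes {1..n}"
  unfolding simple_refl_def by (rule permutes_swap_id) auto

lemma permutes_simple_refl_comp:
  "\<sigma> permutes {1..n} \<Longrightarrow> i \<in> {1..<n} \<Longrightarrow> simple_refl i \<circ> \<sigma> permutes {1..n}"
  by (rule permutes_compose[OF _ permutes_simple_refl])

lemma simple_refl_involutory [simp]: "simple_refl i (simple_refl i x) = x"
  by (simp add: simple_refl_def)

lemma simple_refl_comp_comp [simp]: "simple_refl i \<circ> (simple_refl i \<circ> \<sigma>) = \<sigma>"
  by (auto simp: fun_eq_iff)

lemma inv_simple_refl_comp:
  assumes "\<sigma> permutes {1..n}" "i \<in> {1..<n}"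
  shows "inv (simple_refl i \<circ> \<sigma>) x = inv \<sigma> (simple_refl i x)"
proof -
  have "(simple_refl i \<circ> \<sigma>) (inv \<sigma> (simple_refl i x)) = x"
    using permutes_inverses[OF assms(1)] by simp
  then show ?thesis
    using permutes_inv_eq[OF permutes_simple_refl_comp[OF assms]] by blast
qed

lemma permutes_inv_neq_Suc: "\<sigma> permutes S \<Longrightarrow> inv \<sigma> i \<noteq> inv \<sigma> (Suc i)"
  by (simp add: inj_eq[OF permutes_inj[OF permutes_inv]])

text \<open>Only the values \<open>i\<close> and \<open>Suc i\<close> trade places, and no other
  value lies between them, so every other pair of positions keeps its relative order.\<close>

lemma inversions_simple_refl_comp:
  assumes \<sigma>: "\<sigma> permutes {1..n}" and i: "i \<in> {1..<n}" and less: "inv \<sigma> i < inv \<sigma> (Suc i)"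
  shows "inversions n (simple_refl i \<circ> \<sigma>) = insert (inv \<sigma> i, inv \<sigma> (Suc i)) (inversions n \<sigma>)"
    and "(inv \<sigma> i, inv \<sigma> (Suc i)) \<notin> inversions n \<sigma>"
proof -
  define p q where "p = inv \<sigma> i" and "q = inv \<sigma> (Suc i)"
  have pq: "\<sigma> p = i" "\<sigma> q = Suc i" "p < q"
    using permutes_inverses[OF \<sigma>] less by (auto simp: p_def q_def)
  have in_n: "p \<in> {1..n}" "q \<in> {1..n}"
    using permutes_in_image[OF \<sigma>, of p] permutes_in_image[OF \<sigma>, of q] i pq by auto
  have eq: "\<sigma> x = i \<longleftrightarrow> x = p" "\<sigma> x = Suc i \<longleftrightarrow> x = q" for x
    using pq inj_eq[OF permutes_inj[OF \<sigma>], of x] by metis+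
  have swap: "(simple_refl i \<circ> \<sigma>) x = (if x = p then Suc i else if x = q then i else \<sigma> x)" for x
    using eq[of x] pq by (auto simp: simple_refl_def transpose_def)
  have key: "(x < y \<and> (simple_refl i \<circ> \<sigma>) y < (simple_refl i \<circ> \<sigma>) x) \<longleftrightarrow>
      (x = p \<and> y = q) \<or> (x < y \<and> \<sigma> y < \<sigma> x)" for x y
  proof (cases "x = p \<or> x = q \<or> y = p \<or> y = q")
    case True
    then show ?thesis
      unfolding swap using eq[of x] eq[of y] pq by (elim disjE) (simp_all, linarith+)
  next
    case False
    then show ?thesis unfolding swap by simp
  qed
  show "inversions n (simple_refl i \<circ> \<sigma>) = insert (inv \<sigma> i, inv \<sigma> (Suc i)) (inversions n \<sigma>)"
    unfolding p_def[symmetric] q_def[symmetric] inversions_def using key in_n by auto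
  show "(inv \<sigma> i, inv \<sigma> (Suc i)) \<notin> inversions n \<sigma>"
    using pq unfolding p_def[symmetric] q_def[symmetric] inversions_def by auto
qed

text \<open>The case of a drop is the previous lemma applied to
  \<open>simple_refl i \<circ> \<sigma>\<close>, which the reflection sends back to
  \<open>\<sigma>\<close>. Positivity is stated separately because the \<open>- 1\<close> is
  truncated subtraction.\<close>

lemma card_inversions_simple_refl_comp:
  assumes \<sigma>: "\<sigma> permutes {1..n}" and i: "i \<in> {1..<n}"
  shows "card (inversions n (simple_refl i \<circ> \<sigma>)) =
    (if inv \<sigma> i < inv \<sigma> (Suc i) then Suc (card (inversions n \<sigma>)) else card (inversions n \<sigma>) - 1)"
    and "inv \<sigma> (Suc i) < inv \<sigma> i \<Longrightarrow> 0 < card (inversions n \<sigma>)"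
proof -
  have ne: "inv \<sigma> i \<noteq> inv \<sigma> (Suc i)"
    by (rule permutes_inv_neq_Suc[OF \<sigma>])
  have flip: "card (inversions n \<sigma>) = Suc (card (inversions n (simple_refl i \<circ> \<sigma>)))"
    if "inv \<sigma> (Suc i) < inv \<sigma> i"
  proof -
    have "inv (simple_refl i \<circ> \<sigma>) i < inv (simple_refl i \<circ> \<sigma>) (Suc i)"
      using that unfolding inv_simple_refl_comp[OF \<sigma> i] by (simp add: simple_refl_def)
    from inversions_simple_refl_comp[OF permutes_simple_refl_comp[OF \<sigma> i] i this]
    show ?thesis by (simp add: finite_inversions)
  qed
  then show "card (inversions n (simple_refl i \<circ> \<sigma>)) =
    (if inv \<sigma> i < inv \<sigma> (Suc i) then Suc (card (inversions n \<sigma>)) else card (inversions n \<sigma>) - 1)"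
    using inversions_simple_refl_comp[OF \<sigma> i] ne by (auto simp: finite_inversions)
  show "0 < card (inversions n \<sigma>)" if "inv \<sigma> (Suc i) < inv \<sigma> i"
    using flip[OF that] by simp
qed

text \<open>Increasing steps give \<open>i \<le> \<pi> i\<close>; both sides have the same sum over
  the interval, so no inequality is strict. Several later arguments end here, once no exchange of
  neighbouring values is left to make.\<close>

lemma permutes_increasing_steps_eq_id:
  assumes \<pi>: "\<pi> permutes {1..n}" and step: "\<And>i. i \<in> {1..<n} \<Longrightarrow> \<pi> i < \<pi> (Suc i)"
  shows "\<pi> = id"
proof -
  have ge: "i \<in> {1..n} \<Longrightarrow> i \<le> \<pi> i" for i
  proof (induction i)
    case (Suc i)
    show ?case
    proof (cases "i = 0")
      case True
      then show ?thesis using permutes_in_image[OF \<pi>, of 1] Suc.prems by auto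
    next
      case False
      then show ?thesis using Suc step[of i] by fastforce
    qed
  qed simp
  have "\<pi> i = i" if "i \<in> {1..n}" for i
  proof (rule ccontr)
    assume "\<pi> i \<noteq> i"
    with ge[OF that] have "i < \<pi> i" by simp
    moreover have "(\<Sum>j\<in>{1..n}. \<pi> j) = (\<Sum>j\<in>{1..n}. j)"
      using sum.permute[OF \<pi>, of "\<lambda>j. j"] by simp
    moreover have "(\<Sum>j\<in>{1..n}. j) < (\<Sum>j\<in>{1..n}. \<pi> j)"
      using ge that \<open>i < \<pi> i\<close> by (intro sum_strict_mono_ex1) auto
    ultimately show False by simp
  qed
  then show ?thesis using \<pi> by (auto simp: fun_eq_iff permutes_def)
qed

lemma permutes_comp_inv_eq_idD:
  assumes "\<sigma> permutes {1..n}" "\<rho> \<circ> inv \<sigma> = id"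
  shows "\<rho> = \<sigma>"
  using assms by (metis comp_assoc comp_id id_comp permutes_inv_o(2))

text \<open>As long as an inversion is left, some \<open>Suc i\<close> stands before
  \<open>i\<close>, and multiplying by \<open>simple_refl i\<close> removes exactly one inversion.
  These reflections spell the word.\<close>

lemma exists_word_of_card_inversions:
  assumes "\<sigma> permutes {1..n}"
  shows "\<exists>js. length js = card (inversions n \<sigma>) \<and> set js \<subseteq> {1..<n} \<and>
    \<sigma> = foldr (\<lambda>i f. simple_refl i \<circ> f) js id"
  using assms
proof (induction "card (inversions n \<sigma>)" arbitrary: \<sigma>)
  case 0
  have "inv \<sigma> i < inv \<sigma> (Suc i)" if "i \<in> {1..<n}" for i
  proof -
    have "inv \<sigma> i \<noteq> inv \<sigma> (Suc i)"
      by (rule permutes_inv_neq_Suc[OF 0(2)])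
    then show ?thesis
      using card_inversions_simple_refl_comp(2)[OF 0(2) that] 0(1) by linarith
  qed
  then have "inv \<sigma> = id"
    by (rule permutes_increasing_steps_eq_id[OF permutes_inv[OF 0(2)]])
  then have "\<sigma> = id" using permutes_comp_inv_eq_idD[OF 0(2), of id] by simp
  then show ?case using 0(1) by (intro exI[of _ "[]"]) simp
next
  case (Suc k)
  have "\<exists>i\<in>{1..<n}. inv \<sigma> (Suc i) < inv \<sigma> i"
  proof (rule ccontr)
    assume *: "\<not> ?thesis"
    have "inv \<sigma> i < inv \<sigma> (Suc i)" if "i \<in> {1..<n}" for i
    proof -
      have "inv \<sigma> i \<noteq> inv \<sigma> (Suc i)"
        by (rule permutes_inv_neq_Suc[OF Suc(3)])
      moreover have "\<not> inv \<sigma> (Suc i) < inv \<sigma> i" using * that by blast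
      ultimately show ?thesis by simp
    qed
    then have "inv \<sigma> = id"
      by (rule permutes_increasing_steps_eq_id[OF permutes_inv[OF Suc(3)]])
    then have "\<sigma> = id" using permutes_comp_inv_eq_idD[OF Suc(3), of id] by simp
    then have "inversions n \<sigma> = {}" by (auto simp: inversions_def)
    then show False using Suc(2) by simp
  qed
  then obtain i where i: "i \<in> {1..<n}" "inv \<sigma> (Suc i) < inv \<sigma> i" by blast
  have perm: "simple_refl i \<circ> \<sigma> permutes {1..n}"
    by (rule permutes_simple_refl_comp[OF Suc(3) i(1)])
  have k: "k = card (inversions n (simple_refl i \<circ> \<sigma>))"
    using card_inversions_simple_refl_comp[OF Suc(3) i(1)] i(2) Suc(2) by simp
  from Suc(1)[OF k perm] obtain js where js: "length js = k" "set js \<subseteq> {1..<n}"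
    "simple_refl i \<circ> \<sigma> = foldr (\<lambda>i f. simple_refl i \<circ> f) js id"
    unfolding k[symmetric] by blast
  have "\<sigma> = simple_refl i \<circ> foldr (\<lambda>i f. simple_refl i \<circ> f) js id"
    unfolding js(3)[symmetric] by simp
  then have "\<sigma> = foldr (\<lambda>i f. simple_refl i \<circ> f) (i # js) id" by simp
  moreover have "length (i # js) = card (inversions n \<sigma>)" using js Suc(2) by simp
  moreover have "set (i # js) \<subseteq> {1..<n}" using js(2) i(1) by simp
  ultimately show ?case by blast
qed

text \<open>The matching lower bound for the length of a word: each letter adds at most one
  inversion.\<close>

lemma word_permutes_card_inversions_le:
  assumes "set js \<subseteq> {1..<n}"
  shows "foldr (\<lambda>i f. simple_refl i \<circ> f) js id permutes {1..n} \<and>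
    card (inversions n (foldr (\<lambda>i f. simple_refl i \<circ> f) js id)) \<le> length js"
  using assms
proof (induction js)
  case Nil
  have "inversions n id = {}" by (auto simp: inversions_def)
  then show ?case by (simp add: permutes_id[unfolded id_def] id_def)
next
  case (Cons i js)
  let ?\<sigma> = "foldr (\<lambda>i f. simple_refl i \<circ> f) js id"
  have IH: "?\<sigma> permutes {1..n}" "card (inversions n ?\<sigma>) \<le> length js"
    using Cons.IH[OF order_trans[OF set_subset_Cons Cons.prems]] by blast+
  have i: "i \<in> {1..<n}" using Cons.prems by simp
  have "simple_refl i \<circ> ?\<sigma> permutes {1..n}"
    by (rule permutes_simple_refl_comp[OF IH(1) i])
  moreover have "card (inversions n (simple_refl i \<circ> ?\<sigma>)) \<le> Suc (length js)"
    using card_inversions_simple_refl_comp(1)[OF IH(1) i] IH(2) by (simp split: if_splits)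
  moreover have "foldr (\<lambda>i f. simple_refl i \<circ> f) (i # js) id = simple_refl i \<circ> ?\<sigma>"
    by simp
  ultimately show ?case unfolding length_Cons by metis
qed

section \<open>Coxeter length and left descents\<close>

lemma coxeter_length_eq_card_inversions:
  assumes "\<sigma> permutes {1..n}"
  shows "coxeter_length n \<sigma> = card (inversions n \<sigma>)"
  unfolding coxeter_length_def
proof (rule Least_equality)
  show "\<exists>js. length js = card (inversions n \<sigma>) \<and> set js \<subseteq> {1..<n} \<and>
    \<sigma> = foldr (\<lambda>i f. simple_refl i \<circ> f) js id"
    by (rule exists_word_of_card_inversions[OF assms])
next
  fix k
  assume "\<exists>js. length js = k \<and> set js \<subseteq> {1..<n} \<and> \<sigma> = foldr (\<lambda>i f. simple_refl i \<circ> f) js id"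
  then show "card (inversions n \<sigma>) \<le> k"
    using word_permutes_card_inversions_le by blast
qed

lemma coxeter_length_less_simple_refl_iff:
  assumes "\<sigma> permutes {1..n}" "i \<in> {1..<n}"
  shows "coxeter_length n \<sigma> < coxeter_length n (simple_refl i \<circ> \<sigma>) \<longleftrightarrow> inv \<sigma> i < inv \<sigma> (Suc i)"
  using card_inversions_simple_refl_comp[OF assms]
  unfolding coxeter_length_eq_card_inversions[OF assms(1)]
    coxeter_length_eq_card_inversions[OF permutes_simple_refl_comp[OF assms]]
  by auto

lemma left_descents_eq:
  assumes "\<sigma> permutes {1..n}"
  shows "left_descents n \<sigma> = {i \<in> {1..<n}. inv \<sigma> (Suc i) < inv \<sigma> i}"
proof -
  have "coxeter_length n (simple_refl i \<circ> \<sigma>) < coxeter_length n \<sigma> \<longleftrightarrow> inv \<sigma> (Suc i) < inv \<sigma> i"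
    if "i \<in> {1..<n}" for i
  proof -
    have "inv \<sigma> i \<noteq> inv \<sigma> (Suc i)"
      by (rule permutes_inv_neq_Suc[OF assms])
    then show ?thesis
      using card_inversions_simple_refl_comp[OF assms that]
      unfolding coxeter_length_eq_card_inversions[OF assms]
        coxeter_length_eq_card_inversions[OF permutes_simple_refl_comp[OF assms that]]
      by auto
  qed
  then show ?thesis by (auto simp: left_descents_def)
qed

section \<open>Left weak order as containment of inversion sets\<close>

lemma left_weak_cover_inversions:
  assumes "left_weak_cover n \<sigma> \<rho>"
  shows "\<rho> permutes {1..n} \<and> inversions n \<sigma> \<subseteq> inversions n \<rho>"
proof -
  from assms obtain i where \<sigma>: "\<sigma> permutes {1..n}" and i: "i \<in> {1..<n}"
    and \<rho>: "\<rho> = simple_refl i \<circ> \<sigma>" "coxeter_length n \<sigma> < coxeter_length n \<rho>"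
    unfolding left_weak_cover_def by blast
  then show ?thesis
    using coxeter_length_less_simple_refl_iff[OF \<sigma> i] inversions_simple_refl_comp(1)[OF \<sigma> i]
      permutes_simple_refl_comp[OF \<sigma> i] by blast
qed

text \<open>Climbs from \<open>\<sigma>\<close> by exchanging values \<open>i\<close> and
  \<open>Suc i\<close> that stand in order in \<open>\<sigma>\<close> but at whose positions
  \<open>\<rho>\<close> has an inversion; each exchange uses up one missing inversion. If no such
  \<open>i\<close> exists, \<open>\<rho> \<circ> inv \<sigma>\<close> has increasing steps and is
  the identity.\<close>

lemma left_weak_le_if_inversions_subset:
  assumes "\<sigma> permutes {1..n}" "\<rho> permutes {1..n}" "inversions n \<sigma> \<subseteq> inversions n \<rho>"
  shows "(left_weak_cover n)\<^sup>*\<^sup>* \<sigma> \<rho>"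
  using assms
proof (induction "card (inversions n \<rho> - inversions n \<sigma>)" arbitrary: \<sigma> rule: less_induct)
  case less
  note \<sigma> = less.prems(1) and \<rho> = less.prems(2)
  show ?case
  proof (cases "\<exists>i\<in>{1..<n}. inv \<sigma> i < inv \<sigma> (Suc i) \<and> \<rho> (inv \<sigma> (Suc i)) < \<rho> (inv \<sigma> i)")
    case True
    then obtain i where i: "i \<in> {1..<n}" "inv \<sigma> i < inv \<sigma> (Suc i)"
      "\<rho> (inv \<sigma> (Suc i)) < \<rho> (inv \<sigma> i)" by blast
    let ?\<sigma>' = "simple_refl i \<circ> \<sigma>"
    have "inv \<sigma> i \<in> {1..n}" "inv \<sigma> (Suc i) \<in> {1..n}"
      using i(1) permutes_in_image[OF permutes_inv[OF \<sigma>]] by auto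
    then have in\<rho>: "(inv \<sigma> i, inv \<sigma> (Suc i)) \<in> inversions n \<rho>"
      using i by (simp add: inversions_def)
    note inv' = inversions_simple_refl_comp[OF \<sigma> i(1,2)]
    have "left_weak_cover n \<sigma> ?\<sigma>'"
      unfolding left_weak_cover_def using coxeter_length_less_simple_refl_iff[OF \<sigma> i(1)] i \<sigma> by auto
    moreover have "(left_weak_cover n)\<^sup>*\<^sup>* ?\<sigma>' \<rho>"
    proof (rule less.hyps)
      show "card (inversions n \<rho> - inversions n ?\<sigma>') < card (inversions n \<rho> - inversions n \<sigma>)"
        using inv' in\<rho> by (intro psubset_card_mono) (auto simp: finite_inversions)
      show "?\<sigma>' permutes {1..n}" by (rule permutes_simple_refl_comp[OF \<sigma> i(1)])
      show "inversions n ?\<sigma>' \<subseteq> inversions n \<rho>" using inv' in\<rho> less.prems(3) by auto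
    qed (rule \<rho>)
    ultimately show ?thesis by (rule converse_rtranclp_into_rtranclp)
  next
    case False
    \<comment> \<open>Where \<open>\<sigma>\<close> has \<open>i\<close> before
      \<open>Suc i\<close>, the case assumption keeps \<open>\<rho>\<close> from inverting these
      positions. Otherwise they form an inversion of \<open>\<sigma>\<close>, hence of
      \<open>\<rho>\<close>.\<close>
    have "(\<rho> \<circ> inv \<sigma>) i < (\<rho> \<circ> inv \<sigma>) (Suc i)" if i: "i \<in> {1..<n}" for i
    proof -
      have ne: "\<rho> (inv \<sigma> i) \<noteq> \<rho> (inv \<sigma> (Suc i))" "inv \<sigma> i \<noteq> inv \<sigma> (Suc i)"
        using permutes_inv_neq_Suc[OF \<sigma>] inj_eq[OF permutes_inj[OF \<rho>]] by auto
      show ?thesis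
      proof (cases "inv \<sigma> i < inv \<sigma> (Suc i)")
        case True
        with False i have "\<not> \<rho> (inv \<sigma> (Suc i)) < \<rho> (inv \<sigma> i)" by blast
        with ne show ?thesis by simp
      next
        case False
        have "inv \<sigma> i \<in> {1..n}" "inv \<sigma> (Suc i) \<in> {1..n}"
          using i permutes_in_image[OF permutes_inv[OF \<sigma>]] by auto
        then have "(inv \<sigma> (Suc i), inv \<sigma> i) \<in> inversions n \<sigma>"
          using False ne permutes_inverses[OF \<sigma>] by (auto simp: inversions_def)
        then show ?thesis using less.prems(3) by (auto simp: inversions_def)
      qed
    qed
    then have "\<rho> \<circ> inv \<sigma> = id"
      by (rule permutes_increasing_steps_eq_id[OF permutes_compose[OF permutes_inv[OF \<sigma>] \<rho>]])
    then have "\<rho> = \<sigma>" by (rule permutes_comp_inv_eq_idD[OF \<sigma>])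
    then show ?thesis by simp
  qed
qed

lemma left_weak_le_iff:
  "left_weak_le n \<sigma> \<rho> \<longleftrightarrow>
    \<sigma> permutes {1..n} \<and> \<rho> permutes {1..n} \<and> inversions n \<sigma> \<subseteq> inversions n \<rho>"
proof -
  have "inversions n \<sigma> \<subseteq> inversions n \<rho>" if "(left_weak_cover n)\<^sup>*\<^sup>* \<sigma> \<rho>"
    using that by induction (auto dest: left_weak_cover_inversions)
  then show ?thesis
    unfolding left_weak_le_def using left_weak_le_if_inversions_subset by blast
qed

section \<open>The longest element\<close>

lemma rev_permutes: "(\<lambda>i. if i \<in> {1..n} then Suc n - i else i) permutes {1..n::nat}"
  by (rule bij_imp_permutes, rule bij_betw_byWitness[where f' = "\<lambda>i. Suc n - i"]) auto

text \<open>\<open>ARG_MAX\<close> only promises some maximiser. The reversal inverts every pair, so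
  any maximiser does as well, and composing it with the reversal yields a permutation with
  increasing steps.\<close>

lemma longest_perm:
  shows longest_perm_permutes: "longest_perm n permutes {1..n}"
    and longest_perm_apply: "i \<in> {1..n} \<Longrightarrow> longest_perm n i = Suc n - i"
proof -
  define w where "w = (\<lambda>i. if i \<in> {1..n} then Suc n - i else i)"
  have w: "w permutes {1..n}" unfolding w_def by (rule rev_permutes)
  define A where "A = {(p, q). p \<in> {1..n} \<and> q \<in> {1..n} \<and> p < q}"
  have finA: "finite A"
    by (rule finite_subset[of _ "{1..n} \<times> {1..n}"]) (auto simp: A_def)
  have inv_w: "inversions n w = A" by (auto simp: A_def w_def inversions_def)
  have sub: "inversions n \<sigma> \<subseteq> A" for \<sigma> by (auto simp: A_def inversions_def)
  have "is_arg_max (coxeter_length n) (\<lambda>\<sigma>. \<sigma> permutes {1..n}) w"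
    unfolding is_arg_max_linorder
    using w card_mono[OF finA sub]
    by (metis coxeter_length_eq_card_inversions inv_w not_le)
  then have max: "is_arg_max (coxeter_length n) (\<lambda>\<sigma>. \<sigma> permutes {1..n}) (longest_perm n)"
    unfolding longest_perm_def arg_max_def by (metis someI_ex)
  then show perm: "longest_perm n permutes {1..n}" by (simp add: is_arg_max_def)
  have "card A \<le> card (inversions n (longest_perm n))"
    using max w unfolding is_arg_max_linorder
    by (metis coxeter_length_eq_card_inversions inv_w)
  then have invA: "inversions n (longest_perm n) = A" by (intro card_seteq[OF finA sub])
  have "(\<lambda>i. longest_perm n (w i)) i < (\<lambda>i. longest_perm n (w i)) (Suc i)" if "i \<in> {1..<n}" for i
  proof -
    have "(w (Suc i), w i) \<in> A" using that by (auto simp: A_def w_def)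
    then show ?thesis using invA[symmetric] by (auto simp: inversions_def)
  qed
  moreover have "(\<lambda>i. longest_perm n (w i)) permutes {1..n}"
    using permutes_compose[OF w perm] by (simp add: comp_def)
  ultimately have id: "(\<lambda>i. longest_perm n (w i)) = id"
    by (intro permutes_increasing_steps_eq_id)
  show "longest_perm n i = Suc n - i" if "i \<in> {1..n}"
    using fun_cong[OF id, of "Suc n - i"] that by (auto simp: w_def split: if_splits)
qed

section \<open>Compositions and blocks\<close>

text \<open>Makes the partial sums recursive, so that compositions can be treated by list induction.
  An empty tail is separate because the total sum is not a member.\<close>

lemma set_of_comp_Cons:
  "set_of_comp (b # \<beta>) = (if \<beta> = [] then {} else insert b ((+) b ` set_of_comp \<beta>))"
proof (cases "\<beta> = []")
  case True
  then show ?thesis by (auto simp: set_of_comp_def)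
next
  case False
  have "x \<in> set_of_comp (b # \<beta>) \<longleftrightarrow> x \<in> insert b ((+) b ` set_of_comp \<beta>)" for x
  proof
    assume "x \<in> set_of_comp (b # \<beta>)"
    then obtain i where i: "x = sum_list (take i (b # \<beta>))" "1 \<le> i" "i < length (b # \<beta>)"
      unfolding set_of_comp_def by blast
    then obtain k where "i = Suc k" by (cases i) auto
    show "x \<in> insert b ((+) b ` set_of_comp \<beta>)"
    proof (cases "k = 0")
      case True
      then show ?thesis using i \<open>i = Suc k\<close> by simp
    next
      case False
      then have "sum_list (take k \<beta>) \<in> set_of_comp \<beta>"
        using i(3) \<open>i = Suc k\<close> unfolding set_of_comp_def by force
      then show ?thesis using i(1) \<open>i = Suc k\<close> by simp
    qed
  next
    assume "x \<in> insert b ((+) b ` set_of_comp \<beta>)"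
    then consider "x = b" | i where "x = b + sum_list (take i \<beta>)" "1 \<le> i" "i < length \<beta>"
      unfolding set_of_comp_def by blast
    then show "x \<in> set_of_comp (b # \<beta>)"
    proof cases
      case 1
      then show ?thesis
        using False unfolding set_of_comp_def by (auto intro!: exI[of _ 1])
    next
      case 2
      then show ?thesis
        unfolding set_of_comp_def by (auto intro!: exI[of _ "Suc i"])
    qed
  qed
  with False show ?thesis by auto
qed

lemma compositions_Cons_iff:
  "b # \<beta> \<in> compositions n \<longleftrightarrow> 0 < b \<and> b \<le> n \<and> \<beta> \<in> compositions (n - b)"
  by (auto simp: compositions_def)

lemma set_of_comp_subset: "\<beta> \<in> compositions n \<Longrightarrow> set_of_comp \<beta> \<subseteq> {1..<n}"
proof (induction \<beta> arbitrary: n)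
  case Nil
  then show ?case by (simp add: set_of_comp_def)
next
  case (Cons b \<beta>)
  then have b: "0 < b" "b \<le> n" "\<beta> \<in> compositions (n - b)"
    by (simp_all add: compositions_Cons_iff)
  from Cons.IH[OF b(3)] have "\<forall>x\<in>set_of_comp \<beta>. 1 \<le> x \<and> x < n - b" by fastforce
  moreover have "b < n" if "\<beta> \<noteq> []"
    using that b by (cases \<beta>) (auto simp: compositions_def)
  ultimately show ?case using b by (auto simp: set_of_comp_Cons)
qed

text \<open>Whenever a second part follows, the first part is the least element of the set; removing
  it and shifting leaves the set of the tail.\<close>

lemma inj_on_set_of_comp: "inj_on set_of_comp (compositions n)"
proof (rule inj_onI)
  fix \<beta> \<gamma> assume "\<beta> \<in> compositions n" "\<gamma> \<in> compositions n" "set_of_comp \<beta> = set_of_comp \<gamma>"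
  then show "\<beta> = \<gamma>"
  proof (induction \<beta> arbitrary: \<gamma> n)
    case Nil
    then show ?case by (cases \<gamma>) (auto simp: compositions_def)
  next
    case (Cons b \<beta>)
    from Cons.prems(1,2) obtain c \<delta> where \<gamma>: "\<gamma> = c # \<delta>"
      by (cases \<gamma>) (auto simp: compositions_def)
    have comps: "\<beta> \<in> compositions (n - b)" "\<delta> \<in> compositions (n - c)"
      using Cons.prems(1,2) by (simp_all add: \<gamma> compositions_Cons_iff)
    show ?case
    proof (cases "\<beta> = [] \<or> \<delta> = []")
      case True
      then have "\<beta> = []" "\<delta> = []"
        using Cons.prems(3) by (auto simp: \<gamma> set_of_comp_Cons split: if_splits)
      then show ?thesis using Cons.prems(1,2) by (simp add: \<gamma> compositions_def)
    next
      case False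
      have gt: "\<forall>x\<in>(+) b ` set_of_comp \<beta>. b < x" "\<forall>x\<in>(+) c ` set_of_comp \<delta>. c < x"
        using set_of_comp_subset[OF comps(1)] set_of_comp_subset[OF comps(2)] by fastforce+
      have eq: "insert b ((+) b ` set_of_comp \<beta>) = insert c ((+) c ` set_of_comp \<delta>)"
        using Cons.prems(3) False by (simp add: \<gamma> set_of_comp_Cons)
      then have bc: "b = c" using gt by (metis insertCI insertE not_less_iff_gr_or_eq)
      have "(+) b ` set_of_comp \<beta> = (+) b ` set_of_comp \<delta>"
        using eq gt unfolding bc by (metis insert_ident less_irrefl)
      then have "set_of_comp \<beta> = set_of_comp \<delta>"
        by (simp add: inj_image_eq_iff)
      then show ?thesis using Cons.IH[OF comps(1)] comps(2) by (simp add: \<gamma> bc)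
    qed
  qed
qed

text \<open>Cut at the minimum of \<open>S\<close>: it becomes the first part, and the remaining
  elements, shifted down, belong to a smaller total.\<close>

lemma set_of_comp_surj: "S \<subseteq> {1..<n} \<Longrightarrow> \<exists>\<beta>\<in>compositions n. set_of_comp \<beta> = S"
proof (induction n arbitrary: S rule: less_induct)
  case (less n)
  show ?case
  proof (cases "S = {}")
    case True
    show ?thesis
    proof (cases "n = 0")
      case True
      then show ?thesis using \<open>S = {}\<close>
        by (intro bexI[of _ "[]"]) (auto simp: set_of_comp_def compositions_def)
    next
      case False
      then show ?thesis using \<open>S = {}\<close>
        by (intro bexI[of _ "[n]"]) (auto simp: set_of_comp_Cons compositions_def)
    qed
  next
    case False
    have fin: "finite S" using less.prems finite_subset by blast
    define b where "b = Min S"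
    have b: "b \<in> S" "\<And>x. x \<in> S \<Longrightarrow> b \<le> x"
      using fin False by (auto simp: b_def)
    have bn: "1 \<le> b" "b < n" using b(1) less.prems by auto
    define S' where "S' = (\<lambda>x. x - b) ` (S - {b})"
    have "S' \<subseteq> {1..<n - b}"
      using b less.prems by (fastforce simp: S'_def)
    with less.IH[of "n - b" S'] bn obtain \<beta> where
      \<beta>: "\<beta> \<in> compositions (n - b)" "set_of_comp \<beta> = S'" by auto
    have "\<beta> \<noteq> []" using \<beta>(1) bn by (auto simp: compositions_def)
    moreover have "(+) b ` S' = S - {b}"
      using b(2) by (force simp: S'_def image_image)
    ultimately have "set_of_comp (b # \<beta>) = S"
      using b(1) \<beta>(2) by (auto simp: set_of_comp_Cons)
    then show ?thesis using \<beta>(1) bn by (intro bexI[of _ "b # \<beta>"]) (auto simp: compositions_Cons_iff)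
  qed
qed

lemma comp_of_set:
  assumes "S \<subseteq> {1..<n}"
  shows comp_of_set_in_compositions: "comp_of_set n S \<in> compositions n"
    and set_of_comp_of_set: "set_of_comp (comp_of_set n S) = S"
proof -
  have S: "S \<in> set_of_comp ` compositions n"
    using set_of_comp_surj[OF assms] by blast
  show "comp_of_set n S \<in> compositions n"
    unfolding comp_of_set_def by (rule the_inv_into_into[OF inj_on_set_of_comp S subset_refl])
  show "set_of_comp (comp_of_set n S) = S"
    unfolding comp_of_set_def by (rule f_the_inv_into_f[OF inj_on_set_of_comp S])
qed

lemma set_of_comp_complement_comp_of_set:
  assumes "S \<subseteq> {1..<n}"
  shows "set_of_comp (comp_complement (comp_of_set n S)) = {1..<n} - S"
proof -
  have "sum_list (comp_of_set n S) = n"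
    using comp_of_set_in_compositions[OF assms] by (simp add: compositions_def)
  then show ?thesis
    by (simp add: comp_complement_def set_of_comp_of_set[OF assms] set_of_comp_of_set)
qed

text \<open>Numbers the block containing \<open>v\<close> by counting cut points below it; the
  comparison is strict because a cut point closes its own block. Membership in a
  \<open>block\<close> thus becomes an equation.\<close>

definition block_index :: "nat set \<Rightarrow> nat \<Rightarrow> nat" where
  "block_index S v = Suc (card {s \<in> S. s < v})"

lemma block_index_mono: "finite S \<Longrightarrow> v \<le> w \<Longrightarrow> block_index S v \<le> block_index S w"
  unfolding block_index_def by (auto intro!: card_mono)

lemma block_index_less_iff:
  assumes "finite S"
  shows "block_index S v < block_index S w \<longleftrightarrow> (\<exists>s\<in>S. v \<le> s \<and> s < w)"
proof
  assume less: "block_index S v < block_index S w"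
  have "\<not> {s \<in> S. s < w} \<subseteq> {s \<in> S. s < v}"
    using card_mono[of "{s \<in> S. s < v}" "{s \<in> S. s < w}"] assms less
    by (auto simp: block_index_def)
  then show "\<exists>s\<in>S. v \<le> s \<and> s < w" by force
next
  assume "\<exists>s\<in>S. v \<le> s \<and> s < w"
  then obtain s where s: "s \<in> S" "v \<le> s" "s < w" by blast
  then have "s \<in> {s \<in> S. s < w} - {s \<in> S. s < v}" "{s \<in> S. s < v} \<subseteq> {s \<in> S. s < w}"
    by auto
  then have "{s \<in> S. s < v} \<subset> {s \<in> S. s < w}" by blast
  then show "block_index S v < block_index S w"
    using assms by (simp add: block_index_def psubset_card_mono)
qed

lemma block_index_range: "finite S \<Longrightarrow> block_index S v \<in> {1..card S + 1}"
  unfolding block_index_def by (auto intro!: card_mono)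

text \<open>The leading \<open>0\<close> of \<open>block\<close> is generalised to \<open>a\<close>,
  so that the induction can drop the first cut point and continue from it.\<close>

lemma in_segment_iff_card_less:
  assumes "sorted_wrt (<) (a # xs)" "\<forall>x\<in>set xs. x \<le> n" "k \<le> length xs"
  shows "(a # xs @ [n]) ! k < v \<and> v \<le> (a # xs @ [n]) ! Suc k \<longleftrightarrow>
    a < v \<and> v \<le> (n::nat) \<and> card {s \<in> set xs. s < v} = k"
  using assms
proof (induction xs arbitrary: a k)
  case Nil
  then show ?case by auto
next
  case (Cons x xs)
  have below: "card {s \<in> set (x # xs). s < v} = 0" if "v \<le> x"
  proof -
    have "{s \<in> set (x # xs). s < v} = {}" using Cons.prems(1) that by auto
    then show ?thesis by (simp only: card.empty)
  qed
  have above: "card {s \<in> set (x # xs). s < v} = Suc (card {s \<in> set xs. s < v})" if "x < v"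
  proof -
    have "{s \<in> set (x # xs). s < v} = insert x {s \<in> set xs. s < v}" using that by auto
    then show ?thesis using Cons.prems(1) by auto
  qed
  show ?case
  proof (cases k)
    case 0
    then show ?thesis using below above Cons.prems by (cases "v \<le> x") auto
  next
    case (Suc k')
    then have "(x # xs @ [n]) ! k' < v \<and> v \<le> (x # xs @ [n]) ! Suc k' \<longleftrightarrow>
        x < v \<and> v \<le> n \<and> card {s \<in> set xs. s < v} = k'"
      using Cons.prems by (intro Cons.IH) auto
    then have "(a # (x # xs) @ [n]) ! k < v \<and> v \<le> (a # (x # xs) @ [n]) ! Suc k \<longleftrightarrow>
        x < v \<and> v \<le> n \<and> card {s \<in> set xs. s < v} = k'"
      by (simp only: Suc nth_Cons_Suc append_Cons)
    moreover have "x < v \<and> v \<le> n \<and> card {s \<in> set xs. s < v} = k' \<longleftrightarrow>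
        a < v \<and> v \<le> n \<and> card {s \<in> set (x # xs). s < v} = k"
    proof (cases "v \<le> x")
      case True
      then show ?thesis unfolding below[OF True] Suc by simp
    next
      case False
      then have "x < v" by simp
      then show ?thesis unfolding above[OF \<open>x < v\<close>] Suc using Cons.prems(1) by auto
    qed
    ultimately show ?thesis by (rule trans)
  qed
qed

lemma in_block_iff:
  assumes "S \<subseteq> {1..<n}" "j \<in> {1..card S + 1}"
  shows "v \<in> block n S j \<longleftrightarrow> v \<in> {1..n} \<and> block_index S v = j"
proof -
  have fin: "finite S" using assms(1) finite_subset by blast
  let ?xs = "sorted_list_of_set S"
  have "sorted_wrt (<) (0 # ?xs)" "\<forall>x\<in>set ?xs. x \<le> n" "j - 1 \<le> length ?xs"
    using assms fin by auto
  from in_segment_iff_card_less[OF this, of v]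
  show ?thesis using assms(2) fin by (auto simp: block_def block_index_def Let_def)
qed

section \<open>Linear extensions determine a poset\<close>

text \<open>A maximal element takes the largest label, and induction labels the rest. It exists
  because the converse of a finite acyclic relation is well-founded.\<close>

lemma finite_strict_order_linear_extension:
  assumes "finite A" "trans R" "irrefl R"
  shows "\<exists>f. bij_betw f A {1..card A} \<and> (\<forall>x\<in>A. \<forall>y\<in>A. (x, y) \<in> R \<longrightarrow> f x < (f y :: nat))"
  using assms(1)
proof (induction "card A" arbitrary: A)
  case 0
  then show ?case by (auto simp: bij_betw_def)
next
  case (Suc k)
  define R' where "R' = Restr R A"
  have "acyclic R"
    using assms(2,3) by (simp add: acyclic_irrefl trancl_id)
  then have "acyclic R'" unfolding R'_def by (rule acyclic_subset) blast
  moreover have "finite R'" using Suc by (simp add: R'_def)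
  ultimately have "wf (R'\<inverse>)" by (simp add: finite_acyclic_wf_converse)
  moreover have "A \<noteq> {}" using Suc.hyps(2) by auto
  ultimately have "\<exists>m\<in>A. \<forall>y. (y, m) \<in> R'\<inverse> \<longrightarrow> y \<notin> A"
    unfolding wf_eq_minimal by blast
  then obtain m where m: "m \<in> A" "\<And>y. y \<in> A \<Longrightarrow> (m, y) \<notin> R"
    unfolding R'_def by blast
  have card: "card (A - {m}) = k" using Suc m(1) by simp
  obtain f where
    f: "bij_betw f (A - {m}) {1..k}" "\<forall>x\<in>A - {m}. \<forall>y\<in>A - {m}. (x, y) \<in> R \<longrightarrow> f x < f y"
    using Suc.hyps(1)[of "A - {m}", unfolded card, OF refl] Suc.prems by blast
  define g where "g = f(m := Suc k)"
  have "g ` (A - {m}) = {1..k}" "inj_on g (A - {m})"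
    using f(1) by (auto simp: bij_betw_def g_def inj_on_def)
  moreover have "g m = Suc k" by (simp add: g_def)
  ultimately have "bij_betw g (insert m (A - {m})) (insert (Suc k) {1..k})"
    unfolding bij_betw_def inj_on_insert image_insert by simp
  moreover have "insert m (A - {m}) = A" "insert (Suc k) {1..k} = {1..card A}"
    using m(1) Suc.hyps(2)[symmetric] by auto
  ultimately have "bij_betw g A {1..card A}" by simp
  moreover have "g x < g y" if "x \<in> A" "y \<in> A" "(x, y) \<in> R" for x y
  proof -
    have "x \<noteq> m" using that m(2) by auto
    then have "f x \<in> {1..k}" using bij_betwE[OF f(1)] that by auto
    then show ?thesis using f(2) that \<open>x \<noteq> m\<close> by (auto simp: g_def)
  qed
  ultimately show ?case by blast
qed

text \<open>If \<open>(a, b)\<close> is not in \<open>P\<close>, then \<open>b\<close> may be placed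
  below \<open>a\<close> without creating a cycle; a linear extension of the enlarged order gives
  the permutation.\<close>

lemma exists_Sigma_R_separating:
  assumes P: "partial_order_on {1..n} P" and ab: "a \<in> {1..n}" "b \<in> {1..n}" "(a, b) \<notin> P"
  shows "\<exists>\<sigma>\<in>Sigma_R n P. inv \<sigma> b < inv \<sigma> a"
proof -
  have refl: "\<And>x. x \<in> {1..n} \<Longrightarrow> (x, x) \<in> P" and trans: "\<And>x y z. (x, y) \<in> P \<Longrightarrow> (y, z) \<in> P \<Longrightarrow> (x, z) \<in> P"
    and sub: "\<And>x y. (x, y) \<in> P \<Longrightarrow> x \<in> {1..n} \<and> y \<in> {1..n}"
    and antisym: "\<And>x y. (x, y) \<in> P \<Longrightarrow> (y, x) \<in> P \<Longrightarrow> x = y"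
    using P unfolding partial_order_on_def preorder_on_def refl_on_def trans_def antisym_def
    by blast+
  \<comment> \<open>The strict order generated by \<open>P\<close> and the new relation of
    \<open>b\<close> below \<open>a\<close>: either a step of \<open>P\<close>, or a path through
    \<open>b\<close> and then \<open>a\<close>.\<close>
  define R where "R = {(x, y). x \<noteq> y \<and> (x, y) \<in> P \<or> (x, b) \<in> P \<and> (a, y) \<in> P}"
  have "trans R"
    unfolding trans_def R_def using trans antisym ab(3) by blast
  moreover have "irrefl R"
    unfolding irrefl_def R_def using trans ab(3) by blast
  ultimately obtain f where f: "bij_betw f {1..n} {1..n}"
    "\<And>x y. x \<in> {1..n} \<Longrightarrow> y \<in> {1..n} \<Longrightarrow> (x, y) \<in> R \<Longrightarrow> f x < f y"
    using finite_strict_order_linear_extension[of "{1..n}" R] by auto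
  define g where "g x = (if x \<in> {1..n} then f x else x)" for x
  have "bij_betw g {1..n} {1..n}"
    using f(1) by (rule bij_betw_cong[THEN iffD1, rotated]) (simp add: g_def)
  then have g: "g permutes {1..n}" by (rule bij_imp_permutes) (auto simp: g_def)
  have g_less: "g x < g y" if "(x, y) \<in> R" for x y
    using that f(2)[of x y] sub ab unfolding R_def g_def by auto
  have inv: "inv (inv g) = g" by (rule permutes_inv_inv[OF g])
  \<comment> \<open>\<open>g\<close> assigns positions to elements and \<open>Sigma_R\<close>
    compares values of the inverse permutation, hence \<open>inv g\<close> is the witness.\<close>
  have "inv g \<in> Sigma_R n P"
    unfolding Sigma_R_def using permutes_inv[OF g] g_less by (simp add: inv R_def)
  moreover have "inv (inv g) b < inv (inv g) a"
    unfolding inv using g_less refl ab by (auto simp: R_def)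
  ultimately show ?thesis by blast
qed

text \<open>Gives the uniqueness behind the \<open>THE\<close> of \<open>interval_poset\<close>: a
  pair missing from one order is reversed by one of its extensions, which excludes the pair from the
  other order.\<close>

lemma Sigma_R_determines_poset:
  assumes "partial_order_on {1..n} P" "partial_order_on {1..n} Q" "Sigma_R n P = Sigma_R n Q"
  shows "P = Q"
proof -
  have "P' \<subseteq> Q'" if P': "partial_order_on {1..n} P'" and Q': "partial_order_on {1..n} Q'"
    and eq: "Sigma_R n P' = Sigma_R n Q'" for P' Q'
  proof (rule subrelI, rule ccontr)
    fix a b assume ab: "(a, b) \<in> P'" "(a, b) \<notin> Q'"
    have in_n: "a \<in> {1..n}" "b \<in> {1..n}"
      using P' ab(1) by (auto simp: partial_order_on_def preorder_on_def)
    then have "a \<noteq> b"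
      using Q' ab(2) by (auto simp: partial_order_on_def preorder_on_def refl_on_def)
    obtain \<sigma> where "\<sigma> \<in> Sigma_R n P'" "inv \<sigma> b < inv \<sigma> a"
      using exists_Sigma_R_separating[OF Q' in_n ab(2)] eq by blast
    then show False using ab(1) \<open>a \<noteq> b\<close> unfolding Sigma_R_def by fastforce
  qed
  then show ?thesis using assms by blast
qed

lemma interval_poset_eqI:
  assumes "partial_order_on {1..n} P"
    "Sigma_R n P = {longest_perm n \<circ> inv \<gamma> | \<gamma>. \<gamma> \<in> left_weak_interval n \<sigma> \<rho>}"
  shows "interval_poset n \<sigma> \<rho> = P"
  unfolding interval_poset_def
  using assms Sigma_R_determines_poset by (intro the_equality) metis+

section \<open>Intervals as posets of planar configurations\<close>

text \<open>If the heads differed, each would have to precede the other. An enumeration can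
  therefore be identified by its order and its set alone.\<close>

lemma sorted_wrt_asymp_unique:
  assumes "asymp R" "sorted_wrt R xs" "sorted_wrt R ys" "set xs = set ys"
  shows "xs = ys"
  using assms(2-4)
proof (induction xs arbitrary: ys)
  case Nil
  then show ?case by simp
next
  case (Cons x xs)
  then obtain y ys' where ys: "ys = y # ys'" by (cases ys) auto
  have irr: "\<not> R z z" for z using assms(1) by (auto dest: asympD)
  have "x = y"
  proof (rule ccontr)
    assume "x \<noteq> y"
    then have "x \<in> set ys'" "y \<in> set xs" using Cons.prems(3) by (auto simp: ys)
    then have "R y x" "R x y" using Cons.prems(1,2) by (simp_all add: ys)
    then show False using assms(1) by (auto dest: asympD)
  qed
  moreover have "x \<notin> set xs" "y \<notin> set ys'"
    using Cons.prems irr by (auto simp: ys)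
  ultimately have "set xs = set ys'" using Cons.prems(3) by (auto simp: ys)
  then show ?case using Cons.IH[of ys'] Cons.prems \<open>x = y\<close> by (simp add: ys)
qed

text \<open>The reading order of \<open>row_enum\<close>: second coordinates count rows from the
  bottom, so the larger one comes first.\<close>

definition row_before :: "nat \<times> nat \<Rightarrow> nat \<times> nat \<Rightarrow> bool" where
  "row_before b b' \<longleftrightarrow> snd b' < snd b \<or> snd b = snd b' \<and> fst b < fst b'"

lemma row_enum_sorted:
  assumes "finite D"
  shows "sorted_wrt row_before (row_enum D)" and "set (row_enum D) = D"
proof -
  have fin: "finite {x. (x, y) \<in> D}" for y
    by (rule finite_subset[of _ "fst ` D"]) (use assms in force)+
  have row: "sorted_wrt row_before (map (\<lambda>x. (x, y)) (sorted_list_of_set {x. (x, y) \<in> D}))" for y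
    unfolding sorted_wrt_map
    by (rule sorted_wrt_mono_rel[OF _ strict_sorted_list_of_set]) (simp add: row_before_def)
  have "sorted_wrt row_before
      (concat (map (\<lambda>y. map (\<lambda>x. (x, y)) (sorted_list_of_set {x. (x, y) \<in> D})) ys))"
    if "sorted_wrt (>) ys" for ys
    using that by (induction ys) (auto simp: sorted_wrt_append row row_before_def)
  moreover have "sorted_wrt (>) (rev (sorted_list_of_set (snd ` D)))"
    by (simp add: sorted_wrt_rev)
  ultimately show "sorted_wrt row_before (row_enum D)" unfolding row_enum_def by blast
  show "set (row_enum D) = D"
    using assms fin by (force simp: row_enum_def)
qed

text \<open>Positions taken backwards run through the boxes in reading order, so the
  \<open>i\<close>th box is that of position \<open>Suc n - i\<close>. This reversal is what later
  absorbs the longest element in \<open>interval_poset\<close>.\<close>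

lemma diagram_poset_image:
  assumes "\<And>p q. p \<in> {1..n} \<Longrightarrow> q \<in> {1..n} \<Longrightarrow> p < q \<Longrightarrow> row_before (box q) (box p)"
  shows "diagram_poset (box ` {1..n}) = {(i, j). i \<in> {1..n} \<and> j \<in> {1..n} \<and>
    fst (box (Suc n - i)) \<le> fst (box (Suc n - j)) \<and> snd (box (Suc n - i)) \<le> snd (box (Suc n - j))}"
proof -
  let ?D = "box ` {1..n}"
  let ?xs = "map (\<lambda>i. box (Suc n - i)) [1..<Suc n]"
  have irr: "\<not> row_before b b" for b by (auto simp: row_before_def)
  have "inj_on box {1..n}"
    by (rule inj_onI) (metis assms irr linorder_neqE_nat)
  then have card: "card ?D = n" by (simp add: card_image)
  have "sorted_wrt row_before ?xs"
    unfolding sorted_wrt_map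
    by (rule sorted_wrt_mono_rel[OF _ sorted_wrt_upt]) (auto intro!: assms)
  moreover have "set ?xs = ?D"
  proof -
    have "(\<lambda>i. Suc n - i) ` {1..n} = {1..n}"
      by (rule bij_betw_imp_surj_on[OF bij_betw_byWitness[where f' = "\<lambda>i. Suc n - i"]]) auto
    then have "(\<lambda>i. box (Suc n - i)) ` {1..n} = ?D" by (metis image_image)
    moreover have "set [1..<Suc n] = {1..n}" by auto
    ultimately show ?thesis by (simp only: set_map)
  qed
  moreover have "asymp row_before" by (rule asympI) (auto simp: row_before_def)
  ultimately have enum: "row_enum ?D = ?xs"
    using row_enum_sorted[of ?D] by (intro sorted_wrt_asymp_unique[of row_before]) auto
  have nth: "row_enum ?D ! (i - 1) = box (Suc n - i)" if "i \<in> {1..n}" for i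
    using that unfolding enum by (auto simp del: upt_Suc)
  show ?thesis
    unfolding diagram_poset_def card using nth by auto
qed

text \<open>The definition complements the composition once more, so its rows are cut at
  \<open>S\<close> itself. A box is present when a position of its row block has its value in its
  column block.\<close>

lemma interval_diagram_eq_image:
  assumes \<rho>: "\<rho> permutes {1..n}" and S: "S \<subseteq> {1..<n}"
  shows "interval_diagram (comp_of_set n ({1..<n} - S)) \<rho> =
    (\<lambda>p. (block_index (left_descents n \<rho>) (\<rho> p), block_index S p)) ` {1..n}"
proof -
  let ?K = "left_descents n \<rho>"
  have K: "?K \<subseteq> {1..<n}" by (auto simp: left_descents_def)
  have compl: "{1..<n} - S \<subseteq> {1..<n}" by auto
  have sum: "sum_list (comp_of_set n ({1..<n} - S)) = n"
    using comp_of_set_in_compositions[OF compl] by (simp add: compositions_def)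
  have Z: "set_of_comp (comp_complement (comp_of_set n ({1..<n} - S))) = S"
    using set_of_comp_complement_comp_of_set[OF compl] S by auto
  have fin: "finite ?K" "finite S"
    using K S finite_subset by blast+
  have "(\<rho> ` block n S j \<inter> block n ?K i \<noteq> {}) \<longleftrightarrow>
      (\<exists>p\<in>{1..n}. block_index ?K (\<rho> p) = i \<and> block_index S p = j)"
    if "i \<in> {1..card ?K + 1}" "j \<in> {1..card S + 1}" for i j
    using in_block_iff[OF K that(1)] in_block_iff[OF S that(2)] permutes_in_image[OF \<rho>]
    by blast
  then show ?thesis
    unfolding interval_diagram_def sum Z Let_def
    using block_index_range[OF fin(1)] block_index_range[OF fin(2)] by fast
qed

text \<open>The hypothesis \<open>inv_\<sigma>\<close> describes the longest element of the
  parabolic subgroup of the blocks by its inversions, and \<open>dec_\<rho>\<close> says that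
  \<open>\<rho>\<close> lies above it in left weak order.\<close>

lemma interval_poset_eq_diagram_poset:
  assumes \<sigma>: "\<sigma> permutes {1..n}" and \<rho>: "\<rho> permutes {1..n}" and S: "S \<subseteq> {1..<n}"
    and inv_\<sigma>: "\<And>p q. p \<in> {1..n} \<Longrightarrow> q \<in> {1..n} \<Longrightarrow> p < q \<Longrightarrow>
      \<sigma> q < \<sigma> p \<longleftrightarrow> block_index S p = block_index S q"
    and dec_\<rho>: "\<And>p q. p \<in> {1..n} \<Longrightarrow> q \<in> {1..n} \<Longrightarrow> p < q \<Longrightarrow>
      block_index S p = block_index S q \<Longrightarrow> \<rho> q < \<rho> p"
  shows "interval_poset n \<sigma> \<rho> =
    diagram_poset (interval_diagram (comp_of_set n ({1..<n} - S)) \<rho>)"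
proof -
  define K where "K = left_descents n \<rho>"
  define C where "C p = block_index K (\<rho> p)" for p
  define R where "R = block_index S"
  have K: "K \<subseteq> {1..<n}" by (auto simp: K_def left_descents_def)
  have fin: "finite K" "finite S"
    using K S finite_subset by blast+
  have same_C: "\<rho> p < \<rho> q \<longleftrightarrow> p < q" if "p \<in> {1..n}" "q \<in> {1..n}" "C p = C q" for p q
  proof -
    \<comment> \<open>No left descent separates two values of one block, so the positions increase
      with every step from \<open>x\<close> to \<open>y\<close>.\<close>
    have inv_less: "inv \<rho> x < inv \<rho> y" if "x < y" "x \<in> {1..n}" "y \<le> n"
      "block_index K x = block_index K y" for x y
      using that
    proof (induction y)
      case 0
      then show ?case by simp
    next
      case (Suc y)
      then have "x \<le> y" by simp
      then have "block_index K x \<le> block_index K y" "block_index K y \<le> block_index K (Suc y)"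
        by (simp_all add: block_index_mono[OF fin(1)])
      then have eq: "block_index K x = block_index K y" "\<not> block_index K y < block_index K (Suc y)"
        using Suc.prems(4) by simp_all
      then have "y \<notin> K" by (auto simp: block_index_less_iff[OF fin(1)])
      then have "\<not> inv \<rho> (Suc y) < inv \<rho> y"
        using \<open>x \<le> y\<close> Suc.prems unfolding K_def left_descents_eq[OF \<rho>] by simp
      then have less: "inv \<rho> y < inv \<rho> (Suc y)" using permutes_inv_neq_Suc[OF \<rho>, of y] by simp
      show ?case
      proof (cases "x = y")
        case True
        then show ?thesis using less by simp
      next
        case False
        then have "inv \<rho> x < inv \<rho> y" using Suc.IH Suc.prems \<open>x \<le> y\<close> eq(1) by simp
        then show ?thesis using less by simp
      qed
    qed
    have imp: "p < q" if "p \<in> {1..n}" "q \<in> {1..n}" "C p = C q" "\<rho> p < \<rho> q" for p q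
    proof -
      have "\<rho> p \<in> {1..n}" "\<rho> q \<le> n"
        using that permutes_in_image[OF \<rho>, of p] permutes_in_image[OF \<rho>, of q] by simp_all
      then show ?thesis
        using inv_less[of "\<rho> p" "\<rho> q"] that permutes_inverses(2)[OF \<rho>] by (simp add: C_def)
    qed
    have "\<rho> p \<noteq> \<rho> q" if "p \<noteq> q" using permutes_inj[OF \<rho>] that by (simp add: inj_eq)
    then show ?thesis using imp[of p q] imp[of q p] that by fastforce
  qed
  have C_mono: "C p \<le> C q" if "\<rho> p \<le> \<rho> q" for p q
    unfolding C_def by (rule block_index_mono[OF fin(1) that])
  have R_mono: "R p \<le> R q" if "p \<le> q" for p q
    unfolding R_def by (rule block_index_mono[OF fin(2) that])
  \<comment> \<open>In one row \<open>\<rho>\<close> decreases while in one column it increases, so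
    two positions of a row never share a column.\<close>
  have C_less: "C q < C p" if "p \<in> {1..n}" "q \<in> {1..n}" "p < q" "R p = R q" for p q
  proof -
    have "\<rho> q < \<rho> p" using dec_\<rho> that by (simp add: R_def)
    moreover have "C q \<noteq> C p" using same_C that \<open>\<rho> q < \<rho> p\<close> by fastforce
    ultimately show ?thesis using C_mono[of q p] by simp
  qed
  have inj: "p = q" if "p \<in> {1..n}" "q \<in> {1..n}" "C p = C q" "R p = R q" for p q
    using C_less[of p q] C_less[of q p] that by (metis linorder_neqE_nat less_irrefl)
  \<comment> \<open>Elements of the poset are reversed positions, in agreement with
    \<open>diagram_poset_image\<close>.\<close>
  define P where "P = {(i, j). i \<in> {1..n} \<and> j \<in> {1..n} \<and>
    C (Suc n - i) \<le> C (Suc n - j) \<and> R (Suc n - i) \<le> R (Suc n - j)}"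
  have rev_in: "Suc n - i \<in> {1..n}" if "i \<in> {1..n}" for i using that by auto
  have "diagram_poset (interval_diagram (comp_of_set n ({1..<n} - S)) \<rho>) = P"
  proof -
    have "row_before (C q, R q) (C p, R p)" if "p \<in> {1..n}" "q \<in> {1..n}" "p < q" for p q
      using C_less[OF that] R_mono[of p q] that(3) by (cases "R p = R q") (simp_all add: row_before_def)
    then have "diagram_poset ((\<lambda>p. (C p, R p)) ` {1..n}) = P"
      unfolding P_def by (subst diagram_poset_image) simp_all
    then show ?thesis
      unfolding interval_diagram_eq_image[OF \<rho> S] C_def R_def K_def .
  qed
  moreover have "interval_poset n \<sigma> \<rho> = P"
  proof (rule interval_poset_eqI)
    have "antisym P"
    proof (rule antisymI)
      fix i j assume "(i, j) \<in> P" "(j, i) \<in> P"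
      then have "i \<in> {1..n}" "j \<in> {1..n}" "Suc n - i = Suc n - j"
        using inj[of "Suc n - i" "Suc n - j"] rev_in[of i] rev_in[of j] by (simp_all add: P_def)
      then show "i = j" by auto
    qed
    moreover have "P \<subseteq> {1..n} \<times> {1..n}" "refl_on {1..n} P" "trans P"
      by (auto simp: P_def refl_on_def trans_def)
    ultimately show "partial_order_on {1..n} P"
      unfolding partial_order_on_def preorder_on_def by blast
    \<comment> \<open>The core of the argument: the lower bound \<open>\<sigma>\<close> governs
      pairs within one row, the upper bound \<open>\<rho>\<close> pairs in different rows.\<close>
    have iff: "(\<forall>i j. (i, j) \<in> P \<and> i \<noteq> j \<longrightarrow> \<gamma> (Suc n - i) < \<gamma> (Suc n - j)) \<longleftrightarrow>
        inversions n \<sigma> \<subseteq> inversions n \<gamma> \<and> inversions n \<gamma> \<subseteq> inversions n \<rho>"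
      (is "?mono \<longleftrightarrow> ?between") if \<gamma>: "\<gamma> permutes {1..n}" for \<gamma>
    proof -
      have \<gamma>_eq: "\<gamma> p = \<gamma> q \<longleftrightarrow> p = q" for p q using permutes_inj[OF \<gamma>] by (simp add: inj_eq)
      have "?mono \<longleftrightarrow> (\<forall>p\<in>{1..n}. \<forall>q\<in>{1..n}. p \<noteq> q \<and> C p \<le> C q \<and> R p \<le> R q \<longrightarrow> \<gamma> p < \<gamma> q)"
        (is "_ \<longleftrightarrow> ?mono'")
      proof
        assume m: ?mono
        show ?mono'
        proof (intro ballI impI)
          fix p q
          assume pq: "p \<in> {1..n}" "q \<in> {1..n}" "p \<noteq> q \<and> C p \<le> C q \<and> R p \<le> R q"
          then have sub: "Suc n - (Suc n - p) = p" "Suc n - (Suc n - q) = q"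
            "Suc n - p \<noteq> Suc n - q" by auto
          then have "(Suc n - p, Suc n - q) \<in> P"
            using pq rev_in[OF pq(1)] rev_in[OF pq(2)] by (simp add: P_def)
          then show "\<gamma> p < \<gamma> q"
            using m[rule_format, of "Suc n - p" "Suc n - q"] sub by simp
        qed
      next
        assume m: ?mono'
        show ?mono
        proof (intro allI impI)
          fix i j assume "(i, j) \<in> P \<and> i \<noteq> j"
          then have ij: "i \<in> {1..n}" "j \<in> {1..n}" "i \<noteq> j"
            "C (Suc n - i) \<le> C (Suc n - j)" "R (Suc n - i) \<le> R (Suc n - j)"
            by (simp_all add: P_def)
          then have "Suc n - i \<noteq> Suc n - j" by auto
          then show "\<gamma> (Suc n - i) < \<gamma> (Suc n - j)"
            using m rev_in[OF ij(1)] rev_in[OF ij(2)] ij(4,5) by blast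
        qed
      qed
      also have "\<dots> \<longleftrightarrow> ?between"
      proof
        assume m: ?mono'
        show ?between
        proof (intro conjI subrelI)
          fix p q assume "(p, q) \<in> inversions n \<sigma>"
          then have pq: "p \<in> {1..n}" "q \<in> {1..n}" "p < q" "R p = R q"
            using inv_\<sigma> by (auto simp: inversions_def R_def)
          then have "C q \<le> C p" "q \<noteq> p" using C_less[of p q] by simp_all
          then have "\<gamma> q < \<gamma> p" using m pq by simp
          then show "(p, q) \<in> inversions n \<gamma>" using pq by (simp add: inversions_def)
        next
          fix p q assume "(p, q) \<in> inversions n \<gamma>"
          then have pq: "p \<in> {1..n}" "q \<in> {1..n}" "p < q" "\<gamma> q < \<gamma> p"
            by (auto simp: inversions_def)
          \<comment> \<open>As \<open>p < q\<close> gives \<open>R p \<le> R q\<close>, it is the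
            columns that must strictly decrease, and columns are monotone in the values of
            \<open>\<rho>\<close>.\<close>
          have "\<not> (C p \<le> C q \<and> R p \<le> R q)"
            using m[rule_format, OF pq(1,2)] pq(3,4) by auto
          then have "\<not> \<rho> p \<le> \<rho> q" using C_mono[of p q] R_mono[of p q] pq(3) by auto
          then show "(p, q) \<in> inversions n \<rho>" using pq by (simp add: inversions_def)
        qed
      next
        assume b: ?between
        show ?mono'
        proof (intro ballI impI)
          fix p q assume p: "p \<in> {1..n}" and q: "q \<in> {1..n}"
            and le: "p \<noteq> q \<and> C p \<le> C q \<and> R p \<le> R q"
          show "\<gamma> p < \<gamma> q"
          proof (cases "R p = R q")
            case True
            then have "\<not> p < q" using C_less[OF p q] le by auto
            then have "q < p" using le by simp
            then have "(q, p) \<in> inversions n \<sigma>"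
              using inv_\<sigma>[OF q p] True p q by (simp add: inversions_def R_def)
            then have "(q, p) \<in> inversions n \<gamma>" using b by blast
            then show ?thesis by (simp add: inversions_def)
          next
            case False
            \<comment> \<open>From \<open>p\<close> to \<open>q\<close> the map
              \<open>\<rho>\<close> increases, either along a common column or into a column further
              right. Being bounded by \<open>\<rho>\<close>, \<open>\<gamma>\<close> cannot invert
              the pair.\<close>
            then have "p < q" using R_mono[of q p] le by (metis le_antisym not_le)
            have "\<rho> p < \<rho> q"
            proof (cases "C p = C q")
              case True
              then show ?thesis using same_C[OF p q] \<open>p < q\<close> by simp
            next
              case False
              then show ?thesis using C_mono[of q p] le by (metis le_antisym not_le)
            qed
            then have "(p, q) \<notin> inversions n \<rho>" by (simp add: inversions_def)
            then have "(p, q) \<notin> inversions n \<gamma>" using b by blast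
            then have "\<not> \<gamma> q < \<gamma> p" using p q \<open>p < q\<close> by (simp add: inversions_def)
            then show ?thesis using \<gamma>_eq[of p q] le by simp
          qed
        qed
      qed
      finally show ?thesis .
    qed
    define w where "w = longest_perm n"
    have w: "w permutes {1..n}" and w_apply: "\<And>i. i \<in> {1..n} \<Longrightarrow> w i = Suc n - i"
      unfolding w_def by (rule longest_perm_permutes, erule longest_perm_apply)
    have ww: "w \<circ> w = id"
    proof
      fix i show "(w \<circ> w) i = id i"
      proof (cases "i \<in> {1..n}")
        case True
        then show ?thesis using w_apply[OF True] w_apply[OF rev_in[OF True]] by simp
      next
        case False
        then show ?thesis using permutes_not_in[OF w False] by simp
      qed
    qed
    \<comment> \<open>The inverse of \<open>w \<circ> inv \<gamma>\<close> is
      \<open>\<gamma> \<circ> w\<close>, which turns membership in \<open>Sigma_R\<close> into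
      monotonicity of \<open>\<gamma>\<close> on reversed positions.\<close>
    have inv_comp: "inv (w \<circ> inv \<gamma>) i = \<gamma> (w i)" if "\<gamma> permutes {1..n}" for \<gamma> i
    proof -
      have "(w \<circ> inv \<gamma>) (\<gamma> (w i)) = i"
        using permutes_inverses[OF that] fun_cong[OF ww, of i] by simp
      then show ?thesis
        using permutes_inv_eq[OF permutes_compose[OF permutes_inv[OF that] w]] by blast
    qed
    have mem: "w \<circ> inv \<gamma> \<in> Sigma_R n P \<longleftrightarrow> \<gamma> \<in> left_weak_interval n \<sigma> \<rho>"
      if \<gamma>: "\<gamma> permutes {1..n}" for \<gamma>
    proof -
      have "w \<circ> inv \<gamma> \<in> Sigma_R n P \<longleftrightarrow> (\<forall>i j. (i, j) \<in> P \<and> i \<noteq> j \<longrightarrow> \<gamma> (w i) < \<gamma> (w j))"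
        using permutes_compose[OF permutes_inv[OF \<gamma>] w] by (simp add: Sigma_R_def inv_comp[OF \<gamma>])
      also have "\<dots> \<longleftrightarrow> (\<forall>i j. (i, j) \<in> P \<and> i \<noteq> j \<longrightarrow> \<gamma> (Suc n - i) < \<gamma> (Suc n - j))"
      proof -
        have "w i = Suc n - i \<and> w j = Suc n - j" if "(i, j) \<in> P" for i j
          using that w_apply by (simp add: P_def)
        then show ?thesis by metis
      qed
      also have "\<dots> \<longleftrightarrow> \<gamma> \<in> left_weak_interval n \<sigma> \<rho>"
        unfolding iff[OF \<gamma>] left_weak_interval_def left_weak_le_iff using \<sigma> \<rho> \<gamma> by simp
      finally show ?thesis .
    qed
    show "Sigma_R n P = {longest_perm n \<circ> inv \<gamma> |\<gamma>. \<gamma> \<in> left_weak_interval n \<sigma> \<rho>}"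
      unfolding w_def[symmetric]
    proof (intro equalityI subsetI)
      fix \<pi> assume \<pi>: "\<pi> \<in> Sigma_R n P"
      \<comment> \<open>Solves \<open>\<pi> = w \<circ> inv \<gamma>\<close>, since \<open>w\<close>
        is an involution.\<close>
      define \<gamma> where "\<gamma> = inv \<pi> \<circ> w"
      have \<pi>_perm: "\<pi> permutes {1..n}" using \<pi> by (simp add: Sigma_R_def)
      have \<gamma>: "\<gamma> permutes {1..n}"
        unfolding \<gamma>_def by (rule permutes_compose[OF w permutes_inv[OF \<pi>_perm]])
      have ww_apply: "w (w x) = x" for x using fun_cong[OF ww, of x] by simp
      have "inv \<gamma> = w \<circ> \<pi>"
        by (rule inv_unique_comp)
          (simp_all add: \<gamma>_def fun_eq_iff ww_apply permutes_inverses[OF \<pi>_perm])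
      then have "\<pi> = w \<circ> inv \<gamma>" by (simp add: fun_eq_iff ww_apply)
      then show "\<pi> \<in> {w \<circ> inv \<gamma> |\<gamma>. \<gamma> \<in> left_weak_interval n \<sigma> \<rho>}"
        using mem[OF \<gamma>] \<pi> by blast
    next
      fix \<pi> assume "\<pi> \<in> {w \<circ> inv \<gamma> |\<gamma>. \<gamma> \<in> left_weak_interval n \<sigma> \<rho>}"
      then obtain \<gamma> where \<gamma>: "\<pi> = w \<circ> inv \<gamma>" "\<gamma> \<in> left_weak_interval n \<sigma> \<rho>" by blast
      then have "\<gamma> permutes {1..n}" by (simp add: left_weak_interval_def left_weak_le_def)
      then show "\<pi> \<in> Sigma_R n P" using mem \<gamma> by blast
    qed
  qed
  ultimately show ?thesis by simp
qed

section \<open>Fillings compatible with relations between adjacent columns\<close>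

text \<open>The linear extensions of the order generated by \<open>G\<close>. Extensionality makes a
  filling determined by its values on \<open>B\<close>.\<close>

definition compatible_fillings :: "'b set \<Rightarrow> ('b \<times> 'b) set \<Rightarrow> ('b \<Rightarrow> nat) set" where
  "compatible_fillings B G = {\<tau> \<in> extensional B.
    bij_betw \<tau> B {1..card B} \<and> (\<forall>b b'. (b, b') \<in> G \<longrightarrow> \<tau> b < \<tau> b')}"

lemma compatible_fillings_trancl:
  assumes "\<tau> \<in> compatible_fillings B G" "(b, b') \<in> G\<^sup>+"
  shows "\<tau> b < \<tau> b'"
  using assms(2)
proof induction
  case (base y)
  then show ?case using assms(1) by (simp add: compatible_fillings_def)
next
  case (step y z)
  then have "\<tau> y < \<tau> z" using assms(1) by (simp add: compatible_fillings_def)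
  with step show ?case by simp
qed

lemma bij_betw_eq_card_le:
  assumes "bij_betw \<tau> B {1..card B}" "b \<in> B"
  shows "\<tau> b = card {x \<in> B. \<tau> x \<le> \<tau> b}"
proof -
  have inj: "inj_on \<tau> B" and img: "\<tau> ` B = {1..card B}"
    using assms(1) by (simp_all add: bij_betw_def)
  have "\<tau> b \<le> card B" using img assms(2) by auto
  have "\<tau> ` {x \<in> B. \<tau> x \<le> \<tau> b} = {1..\<tau> b}"
  proof (intro equalityI subsetI)
    fix k assume "k \<in> \<tau> ` {x \<in> B. \<tau> x \<le> \<tau> b}"
    then show "k \<in> {1..\<tau> b}" using img by auto
  next
    fix k assume k: "k \<in> {1..\<tau> b}"
    then have "k \<in> \<tau> ` B" using \<open>\<tau> b \<le> card B\<close> unfolding img by simp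
    then show "k \<in> \<tau> ` {x \<in> B. \<tau> x \<le> \<tau> b}" using k by auto
  qed
  moreover have "inj_on \<tau> {x \<in> B. \<tau> x \<le> \<tau> b}" by (rule inj_on_subset[OF inj]) auto
  ultimately have "card {1..\<tau> b} = card {x \<in> B. \<tau> x \<le> \<tau> b}" by (metis card_image)
  then show ?thesis by simp
qed

text \<open>An entry is the rank of its box, so the relative order of the entries determines the
  filling.\<close>

lemma compatible_fillings_eqI:
  assumes \<tau>: "\<tau> \<in> compatible_fillings B G" "\<tau>' \<in> compatible_fillings B G"
    and less: "\<And>b b'. b \<in> B \<Longrightarrow> b' \<in> B \<Longrightarrow> \<tau> b < \<tau> b' \<Longrightarrow> \<tau>' b < \<tau>' b'"
  shows "\<tau> = \<tau>'"
proof (rule extensionalityI[of _ B])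
  show "\<tau> \<in> extensional B" "\<tau>' \<in> extensional B"
    using \<tau> by (simp_all add: compatible_fillings_def)
  fix b assume b: "b \<in> B"
  have bij: "bij_betw \<tau> B {1..card B}" "bij_betw \<tau>' B {1..card B}"
    using \<tau> by (simp_all add: compatible_fillings_def)
  have "\<tau> x \<le> \<tau> b \<longleftrightarrow> \<tau>' x \<le> \<tau>' b" if x: "x \<in> B" for x
  proof (cases "x = b")
    case False
    then have "\<tau> x \<noteq> \<tau> b" "\<tau>' x \<noteq> \<tau>' b"
      using bij x b by (auto simp: bij_betw_def dest: inj_onD)
    then show ?thesis using less[OF x b] less[OF b x] by linarith
  qed simp
  then have "{x \<in> B. \<tau> x \<le> \<tau> b} = {x \<in> B. \<tau>' x \<le> \<tau>' b}" by blast
  then show "\<tau> b = \<tau>' b"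
    using bij_betw_eq_card_le[OF bij(1) b] bij_betw_eq_card_le[OF bij(2) b] by simp
qed

text \<open>Abstracts what is used of tableaux: generating relations never jump over a column, and
  each column is a chain. Columns are integers so that negating them exchanges sinks and
  sources.\<close>

locale column_graded =
  fixes B :: "'b set" and c :: "'b \<Rightarrow> int" and G :: "('b \<times> 'b) set"
  assumes finite_B: "finite B"
    and relations_in: "(b, b') \<in> G \<Longrightarrow> b \<in> B \<and> b' \<in> B"
    and step_le_one: "(b, b') \<in> G \<Longrightarrow> \<bar>c b - c b'\<bar> \<le> 1"
    and column_total: "b \<in> B \<Longrightarrow> b' \<in> B \<Longrightarrow> c b = c b' \<Longrightarrow> b \<noteq> b' \<Longrightarrow> (b, b') \<in> G \<or> (b', b) \<in> G"
begin

text \<open>A chain of steps of column width at most one has to visit every column between its ends.\<close>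

lemma trancl_regular:
  assumes "(x, z) \<in> G\<^sup>+" "y \<in> B" "c x \<le> c y \<and> c y \<le> c z \<or> c z \<le> c y \<and> c y \<le> c x"
  shows "x = y \<or> y = z \<or> (x, y) \<in> G\<^sup>+ \<or> (y, z) \<in> G\<^sup>+"
proof -
  have single: "x = y \<or> y = z \<or> (x, y) \<in> G\<^sup>+ \<or> (y, z) \<in> G\<^sup>+"
    if "(x, z) \<in> G" "c x \<le> c y \<and> c y \<le> c z \<or> c z \<le> c y \<and> c y \<le> c x" for x z
  proof -
    have "c y = c x \<or> c y = c z" using step_le_one[OF that(1)] that(2) by linarith
    then show ?thesis
    proof
      assume "c y = c x"
      then have "y = x \<or> (x, y) \<in> G \<or> (y, x) \<in> G"
        using column_total[of y x] relations_in[OF that(1)] assms(2) by blast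
      then show ?thesis using that(1) by (meson r_into_trancl trancl_into_trancl2)
    next
      assume "c y = c z"
      then have "y = z \<or> (z, y) \<in> G \<or> (y, z) \<in> G"
        using column_total[of y z] relations_in[OF that(1)] assms(2) by blast
      then show ?thesis using that(1) by (meson r_into_trancl trancl_into_trancl2)
    qed
  qed
  show ?thesis
    using assms(1,3)
  proof (induction rule: trancl_induct)
    case (base z)
    then show ?case using single by blast
  next
    case (step w z)
    consider "c x \<le> c y \<and> c y \<le> c w \<or> c w \<le> c y \<and> c y \<le> c x"
      | "c w \<le> c y \<and> c y \<le> c z \<or> c z \<le> c y \<and> c y \<le> c w"
      using step.prems by linarith
    then show ?case
    proof cases
      case 1
      then have "x = y \<or> y = w \<or> (x, y) \<in> G\<^sup>+ \<or> (y, w) \<in> G\<^sup>+" by (rule step.IH)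
      then show ?thesis using step.hyps(2) by (meson r_into_trancl trancl_into_trancl)
    next
      case 2
      then have "w = y \<or> y = z \<or> (w, y) \<in> G\<^sup>+ \<or> (y, z) \<in> G\<^sup>+"
        by (rule single[OF step.hyps(2)])
      then show ?thesis using step.hyps(1) by (meson trancl_trans)
    qed
  qed
qed

text \<open>The common form of the sink and source conditions: consecutive entries that do not move
  left in the grading \<open>c\<close> must be a generating relation.\<close>

definition locally_forced :: "('b \<Rightarrow> nat) \<Rightarrow> bool" where
  "locally_forced \<tau> \<longleftrightarrow>
    (\<forall>b\<in>B. \<forall>b'\<in>B. \<tau> b' = Suc (\<tau> b) \<and> c b \<le> c b' \<longrightarrow> (b, b') \<in> G)"

text \<open>Induction on the difference of the entries: the box \<open>d\<close> after
  \<open>b\<close> either links \<open>b\<close> to \<open>b'\<close> or overshoots one end, and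
  then \<open>trancl_regular\<close> yields the relation.\<close>

lemma locally_forced_imp_forced:
  assumes \<tau>: "\<tau> \<in> compatible_fillings B G" and loc: "locally_forced \<tau>"
    and b: "b \<in> B" "b' \<in> B" "\<tau> b < \<tau> b'" "c b \<le> c b'"
  shows "(b, b') \<in> G\<^sup>+"
  using b
proof (induction "\<tau> b' - \<tau> b" arbitrary: b rule: less_induct)
  case less
  have less_if: "\<tau> x < \<tau> y" if "(x, y) \<in> G\<^sup>+" for x y
    by (rule compatible_fillings_trancl[OF \<tau> that])
  have img: "\<tau> ` B = {1..card B}" using \<tau> by (simp add: compatible_fillings_def bij_betw_def)
  have "\<tau> b' \<in> {1..card B}" using img less.prems(2) by blast
  then have "Suc (\<tau> b) \<in> \<tau> ` B" unfolding img using less.prems(3) by simp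
  then obtain d where d: "d \<in> B" "\<tau> d = Suc (\<tau> b)" by (metis imageE)
  show ?case
  proof (cases "\<tau> b' = Suc (\<tau> b)")
    case True
    then have "(b, b') \<in> G" using loc less.prems unfolding locally_forced_def by blast
    then show ?thesis by (rule r_into_trancl)
  next
    case False
    then have d_less: "\<tau> d < \<tau> b'" "\<tau> b' - \<tau> d < \<tau> b' - \<tau> b" using less.prems(3) d(2) by simp_all
    have bd: "(b, d) \<in> G\<^sup>+" if "c b \<le> c d"
      using loc less.prems(1) d that unfolding locally_forced_def by blast
    have db': "(d, b') \<in> G\<^sup>+" if "c d \<le> c b'"
      using less.hyps[OF d_less(2) d(1) less.prems(2) d_less(1) that] .
    \<comment> \<open>In the last two cases one end lies in a column between \<open>d\<close> and
      the other end. Regularity compares it with these two, and the order of the entries leaves only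
      \<open>b\<close> below \<open>b'\<close>.\<close>
    consider "c b \<le> c d" "c d \<le> c b'" | "c b' < c d" | "c d < c b" by linarith
    then show ?thesis
    proof cases
      case 1
      then show ?thesis using bd db' by (meson trancl_trans)
    next
      case 2
      then have "(b, d) \<in> G\<^sup>+" using bd less.prems(4) by simp
      then have "b = b' \<or> b' = d \<or> (b, b') \<in> G\<^sup>+ \<or> (b', d) \<in> G\<^sup>+"
        by (rule trancl_regular) (use 2 less.prems in auto)
      then show ?thesis using less.prems(3) d_less(1) less_if[of b' d] by auto
    next
      case 3
      then have "(d, b') \<in> G\<^sup>+" using db' less.prems(4) by simp
      then have "d = b \<or> b = b' \<or> (d, b) \<in> G\<^sup>+ \<or> (b, b') \<in> G\<^sup>+"
        by (rule trancl_regular) (use 3 less.prems in auto)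
      then show ?thesis using less.prems(3) d(2) less_if[of d b] by auto
    qed
  qed
qed

text \<open>If \<open>\<tau>\<close> increases weakly to the right on a pair, this is forced and
  \<open>\<tau>'\<close> agrees. If it increases to the left, the opposite order in
  \<open>\<tau>'\<close> would be forced, contradicting \<open>\<tau>\<close>.\<close>

lemma locally_forced_unique:
  assumes \<tau>: "\<tau> \<in> compatible_fillings B G" "locally_forced \<tau>"
    and \<tau>': "\<tau>' \<in> compatible_fillings B G" "locally_forced \<tau>'"
  shows "\<tau> = \<tau>'"
proof (rule compatible_fillings_eqI[OF \<tau>(1) \<tau>'(1)])
  fix b b' assume b: "b \<in> B" "b' \<in> B" "\<tau> b < \<tau> b'"
  show "\<tau>' b < \<tau>' b'"
  proof (cases "c b \<le> c b'")
    case True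
    show ?thesis
      by (rule compatible_fillings_trancl[OF \<tau>'(1) locally_forced_imp_forced[OF \<tau> b True]])
  next
    case False
    have "\<not> \<tau>' b' < \<tau>' b"
    proof
      assume "\<tau>' b' < \<tau>' b"
      then have "(b', b) \<in> G\<^sup>+"
        using locally_forced_imp_forced[OF \<tau>' b(2,1)] False by simp
      then show False using compatible_fillings_trancl[OF \<tau>(1)] b(3) by fastforce
    qed
    moreover have "\<tau>' b \<noteq> \<tau>' b'"
    proof
      have "inj_on \<tau>' B" using \<tau>'(1) by (simp add: compatible_fillings_def bij_betw_def)
      moreover assume "\<tau>' b = \<tau>' b'"
      ultimately have "b = b'" using b(1,2) by (rule inj_onD)
      then show False using b(3) by simp
    qed
    ultimately show ?thesis by simp
  qed
qed

text \<open>Minimise the number of pairs increasing weakly to the right. Two consecutive entries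
  that do so without being a generating relation could be exchanged, which would lower this
  number.\<close>

lemma locally_forced_exists:
  assumes "compatible_fillings B G \<noteq> {}"
  shows "\<exists>\<tau>\<in>compatible_fillings B G. locally_forced \<tau>"
proof -
  define N where "N \<tau> = {(x, y) \<in> B \<times> B. c x \<le> c y \<and> \<tau> x < \<tau> y}" for \<tau> :: "'b \<Rightarrow> nat"
  have finite_N: "finite (N \<tau>)" for \<tau>
    by (rule finite_subset[of _ "B \<times> B"]) (auto simp: N_def finite_B)
  obtain \<tau> where \<tau>: "\<tau> \<in> compatible_fillings B G"
    and least: "\<And>\<tau>'. \<tau>' \<in> compatible_fillings B G \<Longrightarrow> card (N \<tau>) \<le> card (N \<tau>')"
    using ex_has_least_nat[of "\<lambda>\<tau>. \<tau> \<in> compatible_fillings B G" _ "\<lambda>\<tau>. card (N \<tau>)"] assms by blast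
  have "locally_forced \<tau>"
    unfolding locally_forced_def
  proof (intro ballI impI, rule ccontr)
    fix b b' assume b: "b \<in> B" "b' \<in> B" and *: "\<tau> b' = Suc (\<tau> b) \<and> c b \<le> c b'"
      and notG: "(b, b') \<notin> G"
    have inj: "inj_on \<tau> B" and bij: "bij_betw \<tau> B {1..card B}" and ext: "\<tau> \<in> extensional B"
      and G: "\<And>x y. (x, y) \<in> G \<Longrightarrow> \<tau> x < \<tau> y"
      using \<tau> by (simp_all add: compatible_fillings_def bij_betw_def)
    have "b \<noteq> b'" using * by auto
    have "(b', b) \<notin> G" using G[of b' b] * by auto
    \<comment> \<open>Boxes of one column are always related, so an unrelated pair moves strictly to
      the right and leaves \<open>N\<close> after the exchange.\<close>
    then have "c b < c b'" using column_total[OF b] notG * \<open>b \<noteq> b'\<close> by fastforce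
    define \<tau>' where "\<tau>' = \<tau>(b := \<tau> b', b' := \<tau> b)"
    \<comment> \<open>The two labels are consecutive, so exchanging them affects no other
      comparison.\<close>
    have \<tau>'_less: "\<tau>' x < \<tau>' y \<longleftrightarrow> \<tau> x < \<tau> y"
      if "x \<in> B" "y \<in> B" "(x, y) \<noteq> (b, b')" "(x, y) \<noteq> (b', b)" for x y
    proof -
      have eq: "\<tau> x = \<tau> b \<longleftrightarrow> x = b" "\<tau> x = \<tau> b' \<longleftrightarrow> x = b'" "\<tau> y = \<tau> b \<longleftrightarrow> y = b" "\<tau> y = \<tau> b' \<longleftrightarrow> y = b'"
        using inj_on_eq_iff[OF inj] that(1,2) b by blast+
      show ?thesis
        using eq that(3,4) * unfolding \<tau>'_def fun_upd_def
        by (cases "x = b"; cases "x = b'"; cases "y = b"; cases "y = b'") (simp_all, linarith+)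
    qed
    have "\<tau>' \<in> compatible_fillings B G"
    proof -
      have "\<tau>' \<in> extensional B" using ext b by (auto simp: \<tau>'_def extensional_def)
      moreover have "bij_betw \<tau>' B {1..card B}"
      proof -
        have "bij_betw (transpose b b') B B"
          by (rule permutes_imp_bij[OF permutes_swap_id[OF b]])
        then have "bij_betw (\<tau> \<circ> transpose b b') B {1..card B}" using bij by (rule bij_betw_trans)
        moreover have "\<tau> \<circ> transpose b b' = \<tau>'"
          using \<open>b \<noteq> b'\<close> by (auto simp: fun_eq_iff \<tau>'_def transpose_def)
        ultimately show ?thesis by simp
      qed
      moreover have "\<tau>' x < \<tau>' y" if xy: "(x, y) \<in> G" for x y
      proof -
        have "(x, y) \<noteq> (b, b')" "(x, y) \<noteq> (b', b)" using xy notG \<open>(b', b) \<notin> G\<close> by auto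
        then show ?thesis using \<tau>'_less[of x y] relations_in[OF xy] G[OF xy] by simp
      qed
      ultimately show ?thesis by (simp add: compatible_fillings_def)
    qed
    then have card_le: "card (N \<tau>) \<le> card (N \<tau>')" by (rule least)
    have "N \<tau>' \<subset> N \<tau>"
    proof
      show "N \<tau>' \<subseteq> N \<tau>"
      proof (rule subrelI)
        fix x y assume xy: "(x, y) \<in> N \<tau>'"
        have "\<not> \<tau>' b < \<tau>' b'" using * \<open>b \<noteq> b'\<close> by (simp add: \<tau>'_def)
        then have "(x, y) \<noteq> (b, b')" "(x, y) \<noteq> (b', b)"
          using xy \<open>c b < c b'\<close> by (auto simp: N_def)
        then show "(x, y) \<in> N \<tau>" using xy \<tau>'_less[of x y] by (simp add: N_def)
      qed
      have "(b, b') \<in> N \<tau>" using b * by (simp add: N_def)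
      moreover have "(b, b') \<notin> N \<tau>'" using * \<open>b \<noteq> b'\<close> by (simp add: N_def \<tau>'_def)
      ultimately show "N \<tau>' \<noteq> N \<tau>" by blast
    qed
    then have "card (N \<tau>') < card (N \<tau>)" by (rule psubset_card_mono[OF finite_N])
    then show False using card_le by simp
  qed
  with \<tau> show ?thesis by blast
qed

lemma ex1_locally_forced:
  assumes "compatible_fillings B G \<noteq> {}"
  shows "\<exists>!\<tau>. \<tau> \<in> compatible_fillings B G \<and> locally_forced \<tau>"
  using locally_forced_exists[OF assms] locally_forced_unique by blast

end

section \<open>Equivalence classes of tableaux as sets of compatible fillings\<close>

text \<open>Generators of the order of a class, read off from one member: the column orders,
  neighbours in a row, and the inequalities with a box one column right and lower down that the
  triple condition can prescribe.\<close>

definition tableau_relations ::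
    "nat list \<Rightarrow> (nat \<times> nat \<Rightarrow> nat) \<Rightarrow> ((nat \<times> nat) \<times> (nat \<times> nat)) set" where
  "tableau_relations \<alpha> \<tau> = {(b, b'). b \<in> comp_diagram \<alpha> \<and> b' \<in> comp_diagram \<alpha> \<and> \<tau> b < \<tau> b' \<and>
    (snd b = snd b' \<or> fst b = fst b' \<and> snd b = Suc (snd b') \<or>
     fst b < fst b' \<and> snd b' = Suc (snd b))}"

lemma SRCT_D:
  assumes "\<tau> \<in> SRCT \<alpha>"
  shows SRCT_extensional: "\<tau> \<in> extensional (comp_diagram \<alpha>)"
    and SRCT_bij: "bij_betw \<tau> (comp_diagram \<alpha>) {1..sum_list \<alpha>}"
    and SRCT_row: "\<And>i j j'. (i, j) \<in> comp_diagram \<alpha> \<Longrightarrow> (i, j') \<in> comp_diagram \<alpha> \<Longrightarrow> j < j' \<Longrightarrow>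
      \<tau> (i, j') < \<tau> (i, j)"
    and SRCT_first_column: "\<And>i i'. (i, 1) \<in> comp_diagram \<alpha> \<Longrightarrow> (i', 1) \<in> comp_diagram \<alpha> \<Longrightarrow> i < i' \<Longrightarrow>
      \<tau> (i, 1) < \<tau> (i', 1)"
    and SRCT_triple: "\<And>i j k. i < j \<Longrightarrow> (i, k) \<in> comp_diagram \<alpha> \<Longrightarrow> (j, Suc k) \<in> comp_diagram \<alpha> \<Longrightarrow>
      \<tau> (j, Suc k) < \<tau> (i, k) \<Longrightarrow> (i, Suc k) \<in> comp_diagram \<alpha> \<and> \<tau> (j, Suc k) < \<tau> (i, Suc k)"
  using assms unfolding SRCT_def mem_Collect_eq Suc_eq_plus1 by blast+

lemma SRCT_card:
  assumes "\<tau> \<in> SRCT \<alpha>"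
  shows "finite (comp_diagram \<alpha>)" and "card (comp_diagram \<alpha>) = sum_list \<alpha>"
  using bij_betw_finite[OF SRCT_bij[OF assms]] bij_betw_same_card[OF SRCT_bij[OF assms]] by simp_all

lemma SRCT_neq:
  "\<tau> \<in> SRCT \<alpha> \<Longrightarrow> b \<in> comp_diagram \<alpha> \<Longrightarrow> b' \<in> comp_diagram \<alpha> \<Longrightarrow> b \<noteq> b' \<Longrightarrow> \<tau> b \<noteq> \<tau> b'"
  using SRCT_bij[of \<tau> \<alpha>] by (auto simp: bij_betw_def dest: inj_onD)

lemma SRCT_equiv_less_iff:
  "(\<tau>, \<tau>') \<in> SRCT_equiv \<alpha> \<Longrightarrow> b \<in> comp_diagram \<alpha> \<Longrightarrow> b' \<in> comp_diagram \<alpha> \<Longrightarrow> snd b = snd b' \<Longrightarrow>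
    \<tau> b < \<tau> b' \<longleftrightarrow> \<tau>' b < \<tau>' b'"
  by (cases b; cases b') (auto simp: SRCT_equiv_def)

lemma comp_diagram_left: "(i, Suc j) \<in> comp_diagram \<alpha> \<Longrightarrow> 1 \<le> j \<Longrightarrow> (i, j) \<in> comp_diagram \<alpha>"
  by (simp add: comp_diagram_def)

text \<open>
  If \<open>\<tau> (i, k) > \<tau> (j, k + 1)\<close>, the triple condition follows from
  \<open>\<tau> (i, k + 1) > \<tau> (j, k + 1)\<close>, which is decided by the order within column \<open>k + 1\<close>. So, once the
  column orders are fixed, the triple condition only prescribes some of the inequalities
  \<open>\<tau> (i, k) < \<tau> (j, k + 1)\<close>.
\<close>

lemma SRCT_equiv_triple_less:
  assumes eq: "(\<tau>, \<tau>') \<in> SRCT_equiv \<alpha>" and "i < j"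
    and box: "(i, k) \<in> comp_diagram \<alpha>" "(j, Suc k) \<in> comp_diagram \<alpha>" and less: "\<tau> (i, k) < \<tau> (j, Suc k)"
  shows "\<tau>' (i, k) < \<tau>' (j, Suc k)"
proof (rule ccontr)
  have \<tau>: "\<tau> \<in> SRCT \<alpha>" "\<tau>' \<in> SRCT \<alpha>" using eq by (auto simp: SRCT_equiv_def)
  assume "\<not> ?thesis"
  then have "\<tau>' (j, Suc k) < \<tau>' (i, k)"
    using SRCT_neq[OF \<tau>(2) box] \<open>i < j\<close> by fastforce
  from SRCT_triple[OF \<tau>(2) \<open>i < j\<close> box this]
  have *: "(i, Suc k) \<in> comp_diagram \<alpha>" "\<tau>' (j, Suc k) < \<tau>' (i, Suc k)" by auto
  then have "\<tau> (j, Suc k) < \<tau> (i, Suc k)" using SRCT_equiv_less_iff[OF eq box(2) *(1)] by simp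
  moreover have "\<tau> (i, Suc k) < \<tau> (i, k)" by (rule SRCT_row[OF \<tau>(1) box(1) *(1)]) simp
  ultimately show False using less by simp
qed

text \<open>Columns carry the equivalence, row neighbours chain to whole rows, and the remaining
  generators are shared by the class through \<open>SRCT_equiv_triple_less\<close>.\<close>

lemma SRCT_class_eq_compatible_fillings:
  assumes \<tau>0: "\<tau>0 \<in> SRCT \<alpha>"
  shows "SRCT_equiv \<alpha> `` {\<tau>0} = compatible_fillings (comp_diagram \<alpha>) (tableau_relations \<alpha> \<tau>0)"
    (is "_ = compatible_fillings ?B ?G")
proof (intro equalityI subsetI)
  fix \<tau> assume "\<tau> \<in> SRCT_equiv \<alpha> `` {\<tau>0}"
  then have eq: "(\<tau>0, \<tau>) \<in> SRCT_equiv \<alpha>" by simp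
  then have \<tau>: "\<tau> \<in> SRCT \<alpha>" by (auto simp: SRCT_equiv_def)
  have "\<tau> b < \<tau> b'" if "(b, b') \<in> ?G" for b b'
  proof -
    obtain i k j l where b: "b = (i, k)" "b' = (j, l)" by (metis surj_pair)
    have in_B: "(i, k) \<in> ?B" "(j, l) \<in> ?B" and less: "\<tau>0 (i, k) < \<tau>0 (j, l)"
      and "k = l \<or> i = j \<and> k = Suc l \<or> i < j \<and> l = Suc k"
      using that by (auto simp: b tableau_relations_def)
    then consider "k = l" | "i = j" "k = Suc l" | "i < j" "l = Suc k" by blast
    then show ?thesis
    proof cases
      case 1
      then show ?thesis using SRCT_equiv_less_iff[OF eq in_B] less by (simp add: b)
    next
      case 2
      then show ?thesis using SRCT_row[OF \<tau>, of i l k] in_B by (simp add: b)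
    next
      case 3
      then show ?thesis using SRCT_equiv_triple_less[OF eq 3(1)] in_B less by (simp add: b)
    qed
  qed
  then show "\<tau> \<in> compatible_fillings ?B ?G"
    using SRCT_extensional[OF \<tau>] SRCT_bij[OF \<tau>] SRCT_card[OF \<tau>0]
    by (simp add: compatible_fillings_def)
next
  fix \<tau> assume "\<tau> \<in> compatible_fillings ?B ?G"
  then have ext: "\<tau> \<in> extensional ?B" and bij: "bij_betw \<tau> ?B {1..sum_list \<alpha>}"
    and G: "\<And>b b'. (b, b') \<in> ?G \<Longrightarrow> \<tau> b < \<tau> b'"
    unfolding compatible_fillings_def SRCT_card(2)[OF \<tau>0] by blast+
  \<comment> \<open>Each pair of a column is related in one direction, so preserving the relations
    already reflects the order.\<close>
  have column: "\<tau>0 b < \<tau>0 b' \<longleftrightarrow> \<tau> b < \<tau> b'" if "b \<in> ?B" "b' \<in> ?B" "snd b = snd b'" for b b'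
  proof -
    have "\<tau>0 b < \<tau>0 b' \<Longrightarrow> \<tau> b < \<tau> b'" "\<tau>0 b' < \<tau>0 b \<Longrightarrow> \<tau> b' < \<tau> b"
      using G[of b b'] G[of b' b] that by (simp_all add: tableau_relations_def)
    moreover have "b \<noteq> b' \<Longrightarrow> \<tau>0 b \<noteq> \<tau>0 b'" by (rule SRCT_neq[OF \<tau>0 that(1,2)])
    ultimately show ?thesis by (metis less_asym linorder_neqE_nat)
  qed
  have row_step: "\<tau> (i, Suc j) < \<tau> (i, j)" if "(i, Suc j) \<in> ?B" "(i, j) \<in> ?B" for i j
    using SRCT_row[OF \<tau>0 that(2,1)] that by (intro G) (simp add: tableau_relations_def)
  have row: "\<tau> (i, j') < \<tau> (i, j)" if "(i, j) \<in> ?B" "(i, j') \<in> ?B" "j < j'" for i j j'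
    using that
  proof (induction j')
    case (Suc j')
    show ?case
    proof (cases "j = j'")
      case True
      then show ?thesis using row_step Suc.prems by simp
    next
      case False
      moreover have "1 \<le> j" using Suc.prems(1) by (simp add: comp_diagram_def)
      ultimately have "(i, j') \<in> ?B"
        using comp_diagram_left[OF Suc.prems(2)] Suc.prems(3) by simp
      then show ?thesis using Suc.IH Suc.prems row_step[of i j'] False by simp
    qed
  qed simp
  have triple: "(i, Suc k) \<in> ?B \<and> \<tau> (j, Suc k) < \<tau> (i, Suc k)"
    if "i < j" "(i, k) \<in> ?B" "(j, Suc k) \<in> ?B" "\<tau> (j, Suc k) < \<tau> (i, k)" for i j k
  proof -
    \<comment> \<open>Otherwise this inequality would be a generator and bind \<open>\<tau>\<close>
      too. So \<open>\<tau>0\<close> meets the premise of the triple condition, whose conclusion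
      passes to \<open>\<tau>\<close> within column \<open>Suc k\<close>.\<close>
    have "\<not> \<tau>0 (i, k) < \<tau>0 (j, Suc k)"
      using G[of "(i, k)" "(j, Suc k)"] that by (auto simp: tableau_relations_def)
    then have "\<tau>0 (j, Suc k) < \<tau>0 (i, k)" using SRCT_neq[OF \<tau>0 that(2,3)] that(1) by fastforce
    from SRCT_triple[OF \<tau>0 that(1-3) this]
    have "(i, Suc k) \<in> ?B" "\<tau>0 (j, Suc k) < \<tau>0 (i, Suc k)" by simp_all
    then show ?thesis using column[OF that(3), of "(i, Suc k)"] by simp
  qed
  have first: "\<tau> (i, 1) < \<tau> (i', 1)" if "(i, 1) \<in> ?B" "(i', 1) \<in> ?B" "i < i'" for i i'
    using column[OF that(1,2)] SRCT_first_column[OF \<tau>0 that] by simp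
  have "\<tau> \<in> SRCT \<alpha>"
    unfolding SRCT_def mem_Collect_eq Suc_eq_plus1[symmetric]
    using ext bij row first triple by blast
  then show "\<tau> \<in> SRCT_equiv \<alpha> `` {\<tau>0}"
    using \<tau>0 column by (simp add: SRCT_equiv_def)
qed

section \<open>Sources and sinks as locally forced fillings\<close>

lemma box_of:
  assumes "\<tau> \<in> SRCT \<alpha>"
  shows box_of_in: "i \<in> {1..sum_list \<alpha>} \<Longrightarrow> box_of \<alpha> \<tau> i \<in> comp_diagram \<alpha>"
    and apply_box_of: "i \<in> {1..sum_list \<alpha>} \<Longrightarrow> \<tau> (box_of \<alpha> \<tau> i) = i"
    and box_of_apply: "b \<in> comp_diagram \<alpha> \<Longrightarrow> box_of \<alpha> \<tau> (\<tau> b) = b"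
    and apply_in: "b \<in> comp_diagram \<alpha> \<Longrightarrow> \<tau> b \<in> {1..sum_list \<alpha>}"
proof -
  have inj: "inj_on \<tau> (comp_diagram \<alpha>)" and img: "\<tau> ` comp_diagram \<alpha> = {1..sum_list \<alpha>}"
    using SRCT_bij[OF assms] by (simp_all add: bij_betw_def)
  show "box_of \<alpha> \<tau> i \<in> comp_diagram \<alpha>" if "i \<in> {1..sum_list \<alpha>}"
    unfolding box_of_def by (rule the_inv_into_into[OF inj _ subset_refl]) (use that img in simp)
  show "\<tau> (box_of \<alpha> \<tau> i) = i" if "i \<in> {1..sum_list \<alpha>}"
    unfolding box_of_def by (rule f_the_inv_into_f[OF inj]) (use that img in simp)
  show "box_of \<alpha> \<tau> (\<tau> b) = b" if "b \<in> comp_diagram \<alpha>"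
    unfolding box_of_def by (rule the_inv_into_f_f[OF inj that])
  show "\<tau> b \<in> {1..sum_list \<alpha>}" if "b \<in> comp_diagram \<alpha>"
    using img that by blast
qed

text \<open>Passes between the descent conditions, indexed by entries, and
  \<open>locally_forced\<close>, stated for boxes.\<close>

lemma all_consecutive_boxes_iff:
  assumes "\<tau> \<in> SRCT \<alpha>"
  shows "(\<forall>b\<in>comp_diagram \<alpha>. \<forall>b'\<in>comp_diagram \<alpha>. \<tau> b' = Suc (\<tau> b) \<longrightarrow> Q b b') \<longleftrightarrow>
    (\<forall>i\<in>{1..<sum_list \<alpha>}. Q (box_of \<alpha> \<tau> i) (box_of \<alpha> \<tau> (Suc i)))"
proof (intro iffI ballI impI)
  fix i assume *: "\<forall>b\<in>comp_diagram \<alpha>. \<forall>b'\<in>comp_diagram \<alpha>. \<tau> b' = Suc (\<tau> b) \<longrightarrow> Q b b'"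
    and "i \<in> {1..<sum_list \<alpha>}"
  then have i: "i \<in> {1..sum_list \<alpha>}" "Suc i \<in> {1..sum_list \<alpha>}" by auto
  show "Q (box_of \<alpha> \<tau> i) (box_of \<alpha> \<tau> (Suc i))"
    using * box_of_in[OF assms i(1)] box_of_in[OF assms i(2)]
      apply_box_of[OF assms i(1)] apply_box_of[OF assms i(2)] by simp
next
  fix b b' assume *: "\<forall>i\<in>{1..<sum_list \<alpha>}. Q (box_of \<alpha> \<tau> i) (box_of \<alpha> \<tau> (Suc i))"
    and b: "b \<in> comp_diagram \<alpha>" "b' \<in> comp_diagram \<alpha>" "\<tau> b' = Suc (\<tau> b)"
  have "\<tau> b \<in> {1..<sum_list \<alpha>}"
    using apply_in[OF assms b(1)] apply_in[OF assms b(2)] b(3) by simp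
  with * have "Q (box_of \<alpha> \<tau> (\<tau> b)) (box_of \<alpha> \<tau> (\<tau> b'))" unfolding b(3) by blast
  then show "Q b b'" unfolding box_of_apply[OF assms b(1)] box_of_apply[OF assms b(2)] .
qed

text \<open>Only absolute differences of \<open>c\<close> are fixed, which admits both the column
  number and its negative.\<close>

lemma column_graded_tableau:
  assumes \<tau>: "\<tau> \<in> SRCT \<alpha>"
    and c: "\<And>b b'. \<bar>c b - c b'\<bar> = \<bar>int (snd b) - int (snd b')\<bar>"
  shows "column_graded (comp_diagram \<alpha>) c (tableau_relations \<alpha> \<tau>)"
proof
  show "finite (comp_diagram \<alpha>)" by (rule SRCT_card[OF \<tau>])
  show "b \<in> comp_diagram \<alpha> \<and> b' \<in> comp_diagram \<alpha>" if "(b, b') \<in> tableau_relations \<alpha> \<tau>" for b b'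
    using that by (simp add: tableau_relations_def)
  show "\<bar>c b - c b'\<bar> \<le> 1" if "(b, b') \<in> tableau_relations \<alpha> \<tau>" for b b'
    using that unfolding c by (auto simp: tableau_relations_def)
  show "(b, b') \<in> tableau_relations \<alpha> \<tau> \<or> (b', b) \<in> tableau_relations \<alpha> \<tau>"
    if "b \<in> comp_diagram \<alpha>" "b' \<in> comp_diagram \<alpha>" "c b = c b'" "b \<noteq> b'" for b b'
  proof -
    have "snd b = snd b'" using c[of b b'] that(3) by simp
    then show ?thesis using SRCT_neq[OF \<tau> that(1,2,4)] that(1,2)
      by (auto simp: tableau_relations_def)
  qed
qed

lemma abs_diff_uminus: "\<bar>- x - - y\<bar> = \<bar>x - y :: int\<bar>"
  by simp

text \<open>Row generators point to the left, so a descent can be a generator only within a column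
  or towards the lower right neighbouring column, as in the definition of a sink.\<close>

lemma sink_tableau_iff:
  assumes eq: "(\<tau>0, \<tau>) \<in> SRCT_equiv \<alpha>"
  shows "sink_tableau \<alpha> \<tau> \<longleftrightarrow> column_graded.locally_forced (comp_diagram \<alpha>) (\<lambda>b. int (snd b))
    (tableau_relations \<alpha> \<tau>0) \<tau>"
proof -
  have \<tau>0: "\<tau>0 \<in> SRCT \<alpha>" and \<tau>: "\<tau> \<in> SRCT \<alpha>" using eq by (auto simp: SRCT_equiv_def)
  let ?B = "comp_diagram \<alpha>" and ?G = "tableau_relations \<alpha> \<tau>0"
  have "sink_tableau \<alpha> \<tau> \<longleftrightarrow> (\<forall>i\<in>{1..<sum_list \<alpha>}.
      snd (box_of \<alpha> \<tau> i) \<le> snd (box_of \<alpha> \<tau> (Suc i)) \<longrightarrow>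
      (snd (box_of \<alpha> \<tau> (Suc i)) = snd (box_of \<alpha> \<tau> i) \<or>
       (snd (box_of \<alpha> \<tau> (Suc i)) = Suc (snd (box_of \<alpha> \<tau> i)) \<and>
        fst (box_of \<alpha> \<tau> i) < fst (box_of \<alpha> \<tau> (Suc i)))))"
    unfolding sink_tableau_def tab_descents_def col_of_def row_of_def using \<tau> by auto
  also have "\<dots> \<longleftrightarrow> (\<forall>b\<in>?B. \<forall>b'\<in>?B. \<tau> b' = Suc (\<tau> b) \<longrightarrow> snd b \<le> snd b' \<longrightarrow>
      (snd b' = snd b \<or> snd b' = Suc (snd b) \<and> fst b < fst b'))"
    by (rule all_consecutive_boxes_iff[OF \<tau>, symmetric])
  also have "\<dots> \<longleftrightarrow> (\<forall>b\<in>?B. \<forall>b'\<in>?B. \<tau> b' = Suc (\<tau> b) \<longrightarrow> snd b \<le> snd b' \<longrightarrow> (b, b') \<in> ?G)"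
  proof -
    have "(snd b' = snd b \<or> snd b' = Suc (snd b) \<and> fst b < fst b') \<longleftrightarrow> (b, b') \<in> ?G"
      if b: "b \<in> ?B" "b' \<in> ?B" and suc: "\<tau> b' = Suc (\<tau> b)" and le: "snd b \<le> snd b'" for b b'
    proof
      assume "snd b' = snd b \<or> snd b' = Suc (snd b) \<and> fst b < fst b'"
      then show "(b, b') \<in> ?G"
      proof (elim disjE conjE)
        assume "snd b' = snd b"
        then show ?thesis
          using b SRCT_equiv_less_iff[OF eq b] suc by (simp add: tableau_relations_def)
      next
        assume *: "snd b' = Suc (snd b)" "fst b < fst b'"
        \<comment> \<open>The triple comparison is carried back from \<open>\<tau>\<close> to
          \<open>\<tau>0\<close>, hence the symmetric pair.\<close>
        have eq': "(\<tau>, \<tau>0) \<in> SRCT_equiv \<alpha>" using eq by (auto simp: SRCT_equiv_def)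
        have "\<tau>0 b < \<tau>0 b'"
          using SRCT_equiv_triple_less[OF eq' *(2), of "snd b"] b suc *(1)
          by (metis lessI prod.collapse)
        then show ?thesis using b * by (simp add: tableau_relations_def)
      qed
    next
      assume "(b, b') \<in> ?G"
      then show "snd b' = snd b \<or> snd b' = Suc (snd b) \<and> fst b < fst b'"
        using le by (auto simp: tableau_relations_def)
    qed
    then show ?thesis by blast
  qed
  finally show ?thesis
    unfolding column_graded.locally_forced_def[OF column_graded_tableau[OF \<tau>0 refl]] by auto
qed

text \<open>With columns negated, the test concerns consecutive entries moving weakly left. The only
  generators moving strictly left join row neighbours.\<close>

lemma source_tableau_iff:
  assumes eq: "(\<tau>0, \<tau>) \<in> SRCT_equiv \<alpha>"
  shows "source_tableau \<alpha> \<tau> \<longleftrightarrow> column_graded.locally_forced (comp_diagram \<alpha>) (\<lambda>b. - int (snd b))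
    (tableau_relations \<alpha> \<tau>0) \<tau>"
proof -
  have \<tau>0: "\<tau>0 \<in> SRCT \<alpha>" and \<tau>: "\<tau> \<in> SRCT \<alpha>" using eq by (auto simp: SRCT_equiv_def)
  let ?B = "comp_diagram \<alpha>" and ?G = "tableau_relations \<alpha> \<tau>0"
  have "source_tableau \<alpha> \<tau> \<longleftrightarrow> (\<forall>i\<in>{1..<sum_list \<alpha>}.
      snd (box_of \<alpha> \<tau> (Suc i)) < snd (box_of \<alpha> \<tau> i) \<longrightarrow>
      (fst (box_of \<alpha> \<tau> (Suc i)) = fst (box_of \<alpha> \<tau> i) \<and>
       Suc (snd (box_of \<alpha> \<tau> (Suc i))) = snd (box_of \<alpha> \<tau> i)))"
    unfolding source_tableau_def tab_descents_def col_of_def row_of_def using \<tau>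
    by (auto simp: not_le)
  also have "\<dots> \<longleftrightarrow> (\<forall>b\<in>?B. \<forall>b'\<in>?B. \<tau> b' = Suc (\<tau> b) \<longrightarrow> snd b' < snd b \<longrightarrow>
      (fst b' = fst b \<and> Suc (snd b') = snd b))"
    by (rule all_consecutive_boxes_iff[OF \<tau>, symmetric])
  \<comment> \<open>The strict comparison of columns may become weak, because consecutive entries of
    one column always form a generator.\<close>
  also have "\<dots> \<longleftrightarrow> (\<forall>b\<in>?B. \<forall>b'\<in>?B. \<tau> b' = Suc (\<tau> b) \<longrightarrow> snd b' \<le> snd b \<longrightarrow> (b, b') \<in> ?G)"
  proof -
    have "(snd b' < snd b \<longrightarrow> fst b' = fst b \<and> Suc (snd b') = snd b) \<longleftrightarrow>
        (snd b' \<le> snd b \<longrightarrow> (b, b') \<in> ?G)"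
      if b: "b \<in> ?B" "b' \<in> ?B" and suc: "\<tau> b' = Suc (\<tau> b)" for b b'
    proof -
      have "(b, b') \<in> ?G" if "snd b' = snd b"
        using that b SRCT_equiv_less_iff[OF eq b] suc by (simp add: tableau_relations_def)
      moreover have "(b, b') \<in> ?G" if *: "fst b' = fst b" "Suc (snd b') = snd b"
      proof -
        have "\<tau>0 b < \<tau>0 b'"
          using SRCT_row[OF \<tau>0, of "fst b" "snd b'" "snd b"] b * by (metis lessI prod.collapse)
        then show ?thesis using b * by (simp add: tableau_relations_def)
      qed
      moreover have "fst b' = fst b \<and> Suc (snd b') = snd b" if "(b, b') \<in> ?G" "snd b' < snd b"
        using that by (auto simp: tableau_relations_def)
      ultimately show ?thesis by (metis le_less)
    qed
    then show ?thesis by blast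
  qed
  finally show ?thesis
    unfolding column_graded.locally_forced_def[OF column_graded_tableau[OF \<tau>0 abs_diff_uminus]]
    by auto
qed

section \<open>Reading words\<close>

text \<open>Any representative presents the class as a set of compatible fillings; unique existence
  there gives meaning to the \<open>THE\<close> in \<open>source_of\<close> and
  \<open>sink_of\<close>.\<close>

lemma SRCT_class_source_sink:
  assumes "E \<in> SRCT_classes \<alpha>"
  shows SRCT_class_subset: "E \<subseteq> SRCT \<alpha>"
    and source_of_in: "source_of \<alpha> E \<in> E"
    and source_tableau_source_of: "source_tableau \<alpha> (source_of \<alpha> E)"
    and sink_of_in: "sink_of \<alpha> E \<in> E"
proof -
  obtain \<tau>0 where \<tau>0: "\<tau>0 \<in> SRCT \<alpha>" and E: "E = SRCT_equiv \<alpha> `` {\<tau>0}"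
    using assms unfolding SRCT_classes_def by (auto elim: quotientE)
  show "E \<subseteq> SRCT \<alpha>" unfolding E by (auto simp: SRCT_equiv_def)
  have eq: "(\<tau>0, \<tau>) \<in> SRCT_equiv \<alpha>" if "\<tau> \<in> E" for \<tau> using that E by simp
  have fillings: "E = compatible_fillings (comp_diagram \<alpha>) (tableau_relations \<alpha> \<tau>0)"
    unfolding E by (rule SRCT_class_eq_compatible_fillings[OF \<tau>0])
  have "\<tau>0 \<in> E" unfolding E using \<tau>0 by (simp add: SRCT_equiv_def)
  then have ne: "compatible_fillings (comp_diagram \<alpha>) (tableau_relations \<alpha> \<tau>0) \<noteq> {}"
    unfolding fillings[symmetric] by blast
  have "\<exists>!\<tau>. \<tau> \<in> E \<and> source_tableau \<alpha> \<tau>"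
    using column_graded.ex1_locally_forced[OF column_graded_tableau[OF \<tau>0 abs_diff_uminus] ne]
    unfolding fillings[symmetric] using source_tableau_iff[OF eq] by blast
  from theI'[OF this] show "source_of \<alpha> E \<in> E" "source_tableau \<alpha> (source_of \<alpha> E)"
    unfolding source_of_def by blast+
  have "\<exists>!\<tau>. \<tau> \<in> E \<and> sink_tableau \<alpha> \<tau>"
    using column_graded.ex1_locally_forced[OF column_graded_tableau[OF \<tau>0 refl] ne]
    unfolding fillings[symmetric] using sink_tableau_iff[OF eq] by blast
  from theI'[OF this] show "sink_of \<alpha> E \<in> E" unfolding sink_of_def by blast
qed

text \<open>Inside a block there are no descents, so each next entry sits immediately left in the
  same row.\<close>

lemma source_tableau_block:
  assumes T: "source_tableau \<alpha> T" and i: "1 \<le> i" "i < i'" "i' \<le> sum_list \<alpha>"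
    and block: "block_index (tab_descents \<alpha> T) i = block_index (tab_descents \<alpha> T) i'"
  shows "fst (box_of \<alpha> T i') = fst (box_of \<alpha> T i) \<and> snd (box_of \<alpha> T i') < snd (box_of \<alpha> T i)"
  using i block
proof (induction i')
  case 0
  then show ?case by simp
next
  case (Suc k)
  let ?D = "tab_descents \<alpha> T"
  have fin: "finite ?D" by (simp add: tab_descents_def)
  have "i \<le> k" using Suc.prems by simp
  then have "block_index ?D i \<le> block_index ?D k" "block_index ?D k \<le> block_index ?D (Suc k)"
    by (simp_all add: block_index_mono[OF fin])
  then have eq: "block_index ?D i = block_index ?D k" "\<not> block_index ?D k < block_index ?D (Suc k)"
    using Suc.prems(4) by simp_all
  then have "k \<notin> ?D" by (auto simp: block_index_less_iff[OF fin])
  moreover have "k \<in> {1..sum_list \<alpha>}" "k \<noteq> sum_list \<alpha>" using Suc.prems \<open>i \<le> k\<close> by simp_all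
  ultimately have "fst (box_of \<alpha> T (k + 1)) = fst (box_of \<alpha> T k) \<and>
      snd (box_of \<alpha> T (k + 1)) + 1 = snd (box_of \<alpha> T k)"
    using T unfolding source_tableau_def row_of_def col_of_def by blast
  then have step: "fst (box_of \<alpha> T (Suc k)) = fst (box_of \<alpha> T k)"
      "snd (box_of \<alpha> T (Suc k)) < snd (box_of \<alpha> T k)" by simp_all
  show ?case
  proof (cases "i = k")
    case True
    then show ?thesis using step by simp
  next
    case False
    then show ?thesis using Suc.IH Suc.prems \<open>i \<le> k\<close> eq(1) step by simp
  qed
qed

text \<open>The word of the source: read from left to right, a strip lists its consecutive entries
  in decreasing order.\<close>

primrec rev_segments :: "nat \<Rightarrow> nat list \<Rightarrow> nat list" where
  "rev_segments a [] = []"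
| "rev_segments a (s # ss) = rev [Suc a..<Suc s] @ rev_segments s ss"

text \<open>Passes from the indexed cut points of \<open>block\<close>, where segment
  \<open>j\<close> lies between entries \<open>j - 1\<close> and \<open>j\<close>, to the
  recursion.\<close>

lemma concat_rev_segments:
  "concat (map (\<lambda>j. rev [Suc ((a # ss) ! (j - 1))..<Suc ((a # ss) ! j)]) [1..<Suc (length ss)]) =
    rev_segments a ss"
proof (induction ss arbitrary: a)
  case Nil
  then show ?case by simp
next
  case (Cons s ss)
  have upt: "[1..<Suc (length (s # ss))] = 1 # map Suc [1..<Suc (length ss)]"
    by (simp add: map_Suc_upt upt_conv_Cons del: upt_Suc)
  have "map (\<lambda>j. rev [Suc ((a # s # ss) ! (Suc j - 1))..<Suc ((a # s # ss) ! Suc j)]) [1..<Suc (length ss)]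
    = map (\<lambda>j. rev [Suc ((s # ss) ! (j - 1))..<Suc ((s # ss) ! j)]) [1..<Suc (length ss)]"
    by (rule map_cong[OF refl]) (auto simp: nth_Cons' simp del: upt_Suc)
  then have "concat (map (\<lambda>j. rev [Suc ((a # s # ss) ! (Suc j - 1))..<Suc ((a # s # ss) ! Suc j)])
      [1..<Suc (length ss)]) = rev_segments s ss"
    using Cons.IH[of s] by (simp only:)
  then show ?case
    unfolding upt list.map map_map comp_def concat.simps by (simp del: upt_Suc)
qed

lemma length_rev_segments: "sorted (a # ss) \<Longrightarrow> length (rev_segments a ss) = last (a # ss) - a"
proof (induction ss arbitrary: a)
  case (Cons s ss)
  then have "a \<le> s" "s \<le> last (s # ss)" "sorted (s # ss)" by auto
  moreover have "last (a # s # ss) = last (s # ss)" by simp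
  ultimately show ?case using Cons.IH[of s] by (simp del: upt_Suc last.simps)
qed simp

lemma set_rev_segments: "sorted (a # ss) \<Longrightarrow> set (rev_segments a ss) = {a<..last (a # ss)}"
proof (induction ss arbitrary: a)
  case (Cons s ss)
  then have "a \<le> s" "s \<le> last (s # ss)" "sorted (s # ss)" by auto
  moreover have "last (a # s # ss) = last (s # ss)" by simp
  ultimately show ?case using Cons.IH[of s] by (auto simp del: upt_Suc last.simps)
qed simp

text \<open>Reversing a segment keeps its entries between the same cut points.
  \<open>Suc (a + p)\<close> is the entry at index \<open>p\<close> without the reversals.\<close>

lemma nth_rev_segments_below:
  assumes "sorted (a # ss)" "p < length (rev_segments a ss)"
  shows "{x \<in> set ss. x < rev_segments a ss ! p} = {x \<in> set ss. x < Suc (a + p)}"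
  using assms
proof (induction ss arbitrary: a p)
  case (Cons s ss)
  have sorted: "sorted (s # ss)" and "a \<le> s" using Cons.prems(1) by auto
  show ?case
  proof (cases "p < s - a")
    case True
    then have "rev_segments a (s # ss) ! p = s - p"
      by (simp add: nth_append rev_nth del: upt_Suc)
    then show ?thesis using True Cons.prems(1) by auto
  next
    case False
    define p' where "p' = p - (s - a)"
    have p: "p = (s - a) + p'" using False by (simp add: p'_def)
    have len: "p' < length (rev_segments s ss)" using Cons.prems(2) by (simp add: p del: upt_Suc)
    have nth: "rev_segments a (s # ss) ! p = rev_segments s ss ! p'"
      by (simp add: p nth_append del: upt_Suc)
    have split: "{x \<in> set (s # ss). x < v} = insert s {x \<in> set ss. x < v}" if "s < v" for v
      using that by auto
    have less: "s < rev_segments s ss ! p'" "s < Suc (s + p')"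
      using set_rev_segments[OF sorted] nth_mem[OF len] by simp_all
    have "a + p = s + p'" using \<open>a \<le> s\<close> by (simp add: p)
    then show ?thesis
      unfolding nth split[OF less(1)] Cons.IH[OF sorted len] using split[OF less(2)] by simp
  qed
qed simp

text \<open>A cut point separates entries of different segments, so the condition only speaks about
  pairs within one segment.\<close>

lemma sorted_wrt_rev_segments:
  assumes "sorted (a # ss)"
  shows "sorted_wrt (\<lambda>x y. {z \<in> set ss. z < x} = {z \<in> set ss. z < y} \<longrightarrow> y < x) (rev_segments a ss)"
  using assms
proof (induction ss arbitrary: a)
  case (Cons s ss)
  have sorted: "sorted (s # ss)" using Cons.prems by auto
  have "sorted_wrt (>) (rev [Suc a..<Suc s])"
    by (simp add: sorted_wrt_rev del: upt_Suc)
  then have first: "sorted_wrt (\<lambda>x y. {z \<in> set (s # ss). z < x} = {z \<in> set (s # ss). z < y} \<longrightarrow> y < x)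
      (rev [Suc a..<Suc s])"
    by (rule sorted_wrt_mono_rel[rotated]) simp
  have rest: "sorted_wrt (\<lambda>x y. {z \<in> set (s # ss). z < x} = {z \<in> set (s # ss). z < y} \<longrightarrow> y < x)
      (rev_segments s ss)"
  proof (rule sorted_wrt_mono_rel[OF _ Cons.IH[OF sorted]])
    fix x y assume "x \<in> set (rev_segments s ss)" "y \<in> set (rev_segments s ss)"
      and *: "{z \<in> set ss. z < x} = {z \<in> set ss. z < y} \<longrightarrow> y < x"
    then have "s < x" "s < y" using set_rev_segments[OF sorted] by auto
    show "{z \<in> set (s # ss). z < x} = {z \<in> set (s # ss). z < y} \<longrightarrow> y < x"
    proof
      assume eq: "{z \<in> set (s # ss). z < x} = {z \<in> set (s # ss). z < y}"
      have "{z \<in> set ss. z < x} = {z \<in> set (s # ss). z < x} \<inter> set ss"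
        "{z \<in> set ss. z < y} = {z \<in> set (s # ss). z < y} \<inter> set ss" by auto
      then show "y < x" using * eq by simp
    qed
  qed
  have cross: "\<not> {z \<in> set (s # ss). z < x} = {z \<in> set (s # ss). z < y}"
    if "x \<in> set (rev [Suc a..<Suc s])" "y \<in> set (rev_segments s ss)" for x y
  proof -
    have "x \<le> s" "s < y" using that set_rev_segments[OF sorted] by auto
    then have "s \<in> {z \<in> set (s # ss). z < y}" "s \<notin> {z \<in> set (s # ss). z < x}" by auto
    then show ?thesis by blast
  qed
  show ?case
    unfolding rev_segments.simps sorted_wrt_append using first rest cross by blast
qed simp

text \<open>One-line word of the longest element of the parabolic subgroup generated by the simple
  reflections with index outside \<open>S\<close>.\<close>

definition block_reversal :: "nat \<Rightarrow> nat set \<Rightarrow> nat list" where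
  "block_reversal n S = rev_segments 0 (sorted_list_of_set S @ [n])"

lemma block_reversal:
  assumes S: "S \<subseteq> {1..<n}"
  shows length_block_reversal: "length (block_reversal n S) = n"
    and set_block_reversal: "set (block_reversal n S) = {1..n}"
    and block_index_block_reversal:
      "p \<in> {1..n} \<Longrightarrow> block_index S (block_reversal n S ! (p - 1)) = block_index S p"
    and block_reversal_less_iff: "p \<in> {1..n} \<Longrightarrow> q \<in> {1..n} \<Longrightarrow> p < q \<Longrightarrow>
      block_reversal n S ! (q - 1) < block_reversal n S ! (p - 1) \<longleftrightarrow> block_index S p = block_index S q"
proof -
  let ?ss = "sorted_list_of_set S @ [n]" and ?W = "block_reversal n S"
  have fin: "finite S" using S finite_subset by blast
  have sorted: "sorted (0 # ?ss)" using S fin by (auto simp: sorted_append)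
  show len: "length ?W = n"
    using length_rev_segments[OF sorted] by (simp add: block_reversal_def)
  show set: "set ?W = {1..n}"
  proof -
    have "{0<..n} = {1..n}" by auto
    then show ?thesis using set_rev_segments[OF sorted] by (simp add: block_reversal_def)
  qed
  have below: "{x \<in> set ?ss. x < v} = {x \<in> S. x < v}" if "v \<le> n" for v
    using fin that by auto
  have W_in: "?W ! (p - 1) \<in> {1..n}" if "p \<in> {1..n}" for p
  proof -
    have "p - 1 < length ?W" using that len by auto
    from nth_mem[OF this] show ?thesis unfolding set .
  qed
  show index: "block_index S (?W ! (p - 1)) = block_index S p" if p: "p \<in> {1..n}" for p
  proof -
    have "{x \<in> set ?ss. x < ?W ! (p - 1)} = {x \<in> set ?ss. x < Suc (0 + (p - 1))}"
      unfolding block_reversal_def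
      by (rule nth_rev_segments_below[OF sorted])
        (use p len in \<open>auto simp: block_reversal_def\<close>)
    then show ?thesis using below[of p] below[of "?W ! (p - 1)"] W_in[OF p] p
      by (simp add: block_index_def)
  qed
  show "?W ! (q - 1) < ?W ! (p - 1) \<longleftrightarrow> block_index S p = block_index S q"
    if p: "p \<in> {1..n}" and q: "q \<in> {1..n}" and "p < q" for p q
  proof
    assume less: "?W ! (q - 1) < ?W ! (p - 1)"
    have "block_index S q \<le> block_index S p"
      using block_index_mono[OF fin, of "?W ! (q - 1)" "?W ! (p - 1)"] less index[OF p] index[OF q]
      by simp
    then show "block_index S p = block_index S q"
      using block_index_mono[OF fin, of p q] \<open>p < q\<close> by simp
  next
    assume eq: "block_index S p = block_index S q"
    \<comment> \<open>The sets of cut points below two values are nested, so equal cardinality makes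
      them equal.\<close>
    have sub: "{x \<in> S. x < v} = {x \<in> S. x < w}" if "block_index S v = block_index S w" "v \<le> w" for v w
      using that fin unfolding block_index_def by (intro card_subset_eq) auto
    have "{x \<in> S. x < ?W ! (p - 1)} = {x \<in> S. x < ?W ! (q - 1)}"
      using sub[of "?W ! (p - 1)" "?W ! (q - 1)"] sub[of "?W ! (q - 1)" "?W ! (p - 1)"]
        index[OF p] index[OF q] eq by (metis linear)
    moreover have "{x \<in> set ?ss. x < ?W ! (p - 1)} = {x \<in> set ?ss. x < ?W ! (q - 1)} \<longrightarrow>
        ?W ! (q - 1) < ?W ! (p - 1)"
      using sorted_wrt_nth_less[OF sorted_wrt_rev_segments[OF sorted, folded block_reversal_def],
          of "p - 1" "q - 1"] p q \<open>p < q\<close> len by simp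
    ultimately show "?W ! (q - 1) < ?W ! (p - 1)"
      using below[of "?W ! (p - 1)"] below[of "?W ! (q - 1)"] W_in[OF p] W_in[OF q] by simp
  qed
qed

lemma distinct_block_reversal:
  assumes "S \<subseteq> {1..<n}"
  shows "distinct (block_reversal n S)"
  by (rule card_distinct) (simp add: length_block_reversal[OF assms] set_block_reversal[OF assms])

text \<open>Frees strip words from \<open>the_inv_into\<close>: any list of the boxes with
  increasing columns may be read instead.\<close>

lemma strip_word_eq_map:
  assumes "set xs = H" "sorted_wrt (\<lambda>b b'. snd b < snd b') xs"
  shows "strip_word H \<tau> = map \<tau> xs"
proof -
  have sorted: "sorted_wrt (<) (map snd xs)" using assms(2) by (simp add: sorted_wrt_map)
  then have "distinct (map snd xs)" by (simp add: strict_sorted_iff)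
  then have inj: "inj_on snd H" using assms(1) by (simp add: distinct_map)
  have "sorted_list_of_set (snd ` H) = map snd xs"
    using sorted_list_of_set.idem_if_sorted_distinct[of "map snd xs"] sorted assms(1)
    by (simp add: strict_sorted_iff)
  moreover have "the_inv_into H snd (snd b) = b" if "b \<in> set xs" for b
    by (rule the_inv_into_f_f[OF inj]) (use that assms(1) in simp)
  ultimately show ?thesis unfolding strip_word_def by simp
qed

text \<open>All words of the class visit the boxes in one order, that of the source, so they differ
  only in the filling applied at the end.\<close>

lemma read_word_eq:
  assumes E: "E \<in> SRCT_classes \<alpha>"
  defines "T \<equiv> source_of \<alpha> E"
  shows "read_word \<alpha> E \<tau> =
    map (\<lambda>v. \<tau> (box_of \<alpha> T v)) (block_reversal (sum_list \<alpha>) (tab_descents \<alpha> T))"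
proof -
  define D where "D = tab_descents \<alpha> T"
  define n where "n = sum_list \<alpha>"
  define s where "s = 0 # sorted_list_of_set D @ [n]"
  have D: "D \<subseteq> {1..<n}" by (auto simp: D_def n_def tab_descents_def)
  then have fin: "finite D" using finite_subset by blast
  have T: "T \<in> SRCT \<alpha>" "source_tableau \<alpha> T"
    using SRCT_class_subset[OF E] source_of_in[OF E] source_tableau_source_of[OF E]
    by (auto simp: T_def)
  have strip: "strip_word (strip \<alpha> E j) \<tau> =
      map (\<lambda>v. \<tau> (box_of \<alpha> T v)) (rev [Suc (s ! (j - 1))..<Suc (s ! j)])"
    if j: "j \<in> {1..card D + 1}" for j
  proof -
    have block: "set [Suc (s ! (j - 1))..<Suc (s ! j)] = block n D j"
      by (auto simp: block_def s_def Let_def)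
    have in_block: "v \<in> block n D j \<longleftrightarrow> v \<in> {1..n} \<and> block_index D v = j" for v
      by (rule in_block_iff[OF D j])
    have H: "strip \<alpha> E j = {b \<in> comp_diagram \<alpha>. T b \<in> block n D j}"
      by (simp add: strip_def T_def D_def n_def)
    let ?xs = "map (box_of \<alpha> T) (rev [Suc (s ! (j - 1))..<Suc (s ! j)])"
    have "set ?xs = strip \<alpha> E j"
      unfolding set_map set_rev block H
    proof (intro equalityI subsetI)
      fix b assume "b \<in> box_of \<alpha> T ` block n D j"
      then obtain v where v: "v \<in> block n D j" "b = box_of \<alpha> T v" by blast
      then have "v \<in> {1..sum_list \<alpha>}" using in_block by (simp add: n_def)
      then show "b \<in> {b \<in> comp_diagram \<alpha>. T b \<in> block n D j}"
        using v box_of_in[OF T(1)] apply_box_of[OF T(1)] by simp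
    next
      fix b assume "b \<in> {b \<in> comp_diagram \<alpha>. T b \<in> block n D j}"
      then show "b \<in> box_of \<alpha> T ` block n D j"
        using box_of_apply[OF T(1)] by (metis (mono_tags, lifting) image_eqI mem_Collect_eq)
    qed
    \<comment> \<open>Larger entries of a block lie further left in the source, so the reversed list
      of entries runs from left to right.\<close>
    moreover have "sorted_wrt (\<lambda>b b'. snd b < snd b') ?xs"
      unfolding sorted_wrt_map sorted_wrt_rev
    proof (rule sorted_wrt_mono_rel[OF _ sorted_wrt_upt])
      fix v w assume "v \<in> set [Suc (s ! (j - 1))..<Suc (s ! j)]"
        "w \<in> set [Suc (s ! (j - 1))..<Suc (s ! j)]" "v < w"
      then have "v \<in> {1..n}" "w \<in> {1..n}" "block_index D v = block_index D w"
        unfolding block in_block by simp_all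
      then show "snd (box_of \<alpha> T w) < snd (box_of \<alpha> T v)"
        using source_tableau_block[OF T(2), of v w] \<open>v < w\<close> by (simp add: D_def n_def)
    qed
    ultimately show ?thesis by (simp only: strip_word_eq_map map_map comp_def)
  qed
  have "read_word \<alpha> E \<tau> = concat (map (\<lambda>j. strip_word (strip \<alpha> E j) \<tau>) [1..<Suc (card D + 1)])"
    by (simp add: read_word_def T_def D_def)
  also have "\<dots> = concat (map (\<lambda>j. map (\<lambda>v. \<tau> (box_of \<alpha> T v)) (rev [Suc (s ! (j - 1))..<Suc (s ! j)]))
      [1..<Suc (card D + 1)])"
    by (rule arg_cong[where f = concat], rule map_cong[OF refl]) (rule strip, auto)
  also have "\<dots> = map (\<lambda>v. \<tau> (box_of \<alpha> T v))
      (concat (map (\<lambda>j. rev [Suc (s ! (j - 1))..<Suc (s ! j)]) [1..<Suc (card D + 1)]))"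
    unfolding map_concat map_map comp_def ..
  also have "concat (map (\<lambda>j. rev [Suc (s ! (j - 1))..<Suc (s ! j)]) [1..<Suc (card D + 1)]) =
      block_reversal n D"
    using concat_rev_segments[of 0 "sorted_list_of_set D @ [n]"]
    by (simp add: s_def block_reversal_def del: upt_Suc)
  finally show ?thesis by (simp add: D_def n_def)
qed

lemma perm_of_word_permutes:
  assumes "distinct w" "set w = {1..length w}"
  shows "perm_of_word w permutes {1..length w}"
proof (rule bij_imp_permutes)
  have "bij_betw (\<lambda>i. i - 1) {1..length w} {..<length w}"
    by (rule bij_betw_byWitness[where f' = Suc]) auto
  moreover have "bij_betw ((!) w) {..<length w} {1..length w}"
    using bij_betw_nth[OF assms(1) refl] assms(2) by simp
  ultimately have "bij_betw ((!) w \<circ> (\<lambda>i. i - 1)) {1..length w} {1..length w}"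
    by (rule bij_betw_trans)
  then show "bij_betw (perm_of_word w) {1..length w} {1..length w}"
    by (rule bij_betw_cong[THEN iffD1, rotated]) (auto simp: perm_of_word_def)
qed (auto simp: perm_of_word_def)

section \<open>Application to the words of source and sink\<close>

theorem theorem5p12:
  fixes n :: nat and \<alpha> :: "nat list" and E :: "(nat \<times> nat \<Rightarrow> nat) set"
  assumes "\<alpha> \<in> compositions n"
    and "E \<in> SRCT_classes \<alpha>"
  shows "class_poset \<alpha> E =
    diagram_poset (interval_diagram
      (comp_of_set n ({1..<n} - tab_descents \<alpha> (source_of \<alpha> E)))
      (read_perm \<alpha> E (sink_of \<alpha> E)))"
proof -
  define T where "T = source_of \<alpha> E"
  define D where "D = tab_descents \<alpha> T"
  define W where "W = block_reversal n D"
  have n: "sum_list \<alpha> = n" using assms(1) by (simp add: compositions_def)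
  have D: "D \<subseteq> {1..<n}" by (auto simp: D_def n tab_descents_def)
  have T: "T \<in> SRCT \<alpha>" "source_tableau \<alpha> T"
    using SRCT_class_subset[OF assms(2)] source_of_in[OF assms(2)]
      source_tableau_source_of[OF assms(2)] by (auto simp: T_def)
  have len: "length W = n" and set: "set W = {1..n}"
    unfolding W_def using block_reversal[OF D] by blast+
  have W_in: "W ! (p - 1) \<in> {1..n}" if "p \<in> {1..n}" for p
  proof -
    have "p - 1 < length W" using that len by auto
    from nth_mem[OF this] show ?thesis unfolding set .
  qed
  have word: "read_word \<alpha> E \<tau> = map (\<lambda>v. \<tau> (box_of \<alpha> T v)) W" for \<tau>
    using read_word_eq[OF assms(2)] by (simp add: T_def D_def W_def n)
  have read: "read_perm \<alpha> E \<tau> p = \<tau> (box_of \<alpha> T (W ! (p - 1)))" if "p \<in> {1..n}" for \<tau> p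
  proof -
    have "p - 1 < length W" using that len by auto
    then show ?thesis
      using that len by (simp add: read_perm_def perm_of_word_def word del: One_nat_def)
  qed
  have perm: "read_perm \<alpha> E \<tau> permutes {1..n}" if \<tau>: "\<tau> \<in> SRCT \<alpha>" for \<tau>
  proof -
    have "bij_betw (box_of \<alpha> T) {1..n} (comp_diagram \<alpha>)"
      unfolding box_of_def using bij_betw_the_inv_into[OF SRCT_bij[OF T(1)]] by (simp add: n)
    then have bij: "bij_betw (\<tau> \<circ> box_of \<alpha> T) {1..n} {1..n}"
      using SRCT_bij[OF \<tau>] unfolding n by (rule bij_betw_trans)
    then have "set (read_word \<alpha> E \<tau>) = {1..n}"
      unfolding word set_map set by (simp add: bij_betw_def image_comp)
    moreover have "distinct (read_word \<alpha> E \<tau>)"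
      unfolding word distinct_map set using bij distinct_block_reversal[OF D]
      by (simp add: W_def bij_betw_def comp_def)
    ultimately show ?thesis
      unfolding read_perm_def using perm_of_word_permutes[of "read_word \<alpha> E \<tau>"] len
      by (simp add: word)
  qed
  \<comment> \<open>\<open>T\<close> undoes \<open>box_of \<alpha> T\<close>, so the source reads
    the block reversal itself, the lower bound required by the interval lemma.\<close>
  have read_T: "read_perm \<alpha> E T p = W ! (p - 1)" if "p \<in> {1..n}" for p
    using read[OF that] apply_box_of[OF T(1)] W_in[OF that] by (simp add: n)
  have sink: "sink_of \<alpha> E \<in> SRCT \<alpha>"
    using SRCT_class_subset[OF assms(2)] sink_of_in[OF assms(2)] by blast
  have "interval_poset n (read_perm \<alpha> E T) (read_perm \<alpha> E (sink_of \<alpha> E)) =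
    diagram_poset (interval_diagram (comp_of_set n ({1..<n} - D)) (read_perm \<alpha> E (sink_of \<alpha> E)))"
  proof (rule interval_poset_eq_diagram_poset[OF perm[OF T(1)] perm[OF sink] D])
    fix p q assume p: "p \<in> {1..n}" and q: "q \<in> {1..n}" and "p < q"
    show less_iff: "read_perm \<alpha> E T q < read_perm \<alpha> E T p \<longleftrightarrow> block_index D p = block_index D q"
      unfolding read_T[OF p] read_T[OF q] W_def by (rule block_reversal_less_iff[OF D p q \<open>p < q\<close>])
    assume eq: "block_index D p = block_index D q"
    \<comment> \<open>Positions in one block visit boxes of a single row from left to right, and
      every tableau decreases along its rows; hence the word of the sink decreases there.\<close>
    let ?v = "W ! (p - 1)" and ?w = "W ! (q - 1)"
    have "?w < ?v" using less_iff eq unfolding read_T[OF p] read_T[OF q] by simp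
    moreover have "block_index D ?w = block_index D ?v"
      using block_index_block_reversal[OF D] p q eq by (simp add: W_def)
    ultimately have "fst (box_of \<alpha> T ?v) = fst (box_of \<alpha> T ?w)"
      "snd (box_of \<alpha> T ?v) < snd (box_of \<alpha> T ?w)"
      using source_tableau_block[OF T(2), of ?w ?v] W_in[OF p] W_in[OF q] by (simp_all add: D_def n)
    moreover have "box_of \<alpha> T ?v \<in> comp_diagram \<alpha>" "box_of \<alpha> T ?w \<in> comp_diagram \<alpha>"
      using box_of_in[OF T(1)] W_in[OF p] W_in[OF q] by (simp_all add: n)
    ultimately have "sink_of \<alpha> E (box_of \<alpha> T ?w) < sink_of \<alpha> E (box_of \<alpha> T ?v)"
      using SRCT_row[OF sink, of "fst (box_of \<alpha> T ?w)" "snd (box_of \<alpha> T ?v)" "snd (box_of \<alpha> T ?w)"]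
      by (metis prod.collapse)
    then show "read_perm \<alpha> E (sink_of \<alpha> E) q < read_perm \<alpha> E (sink_of \<alpha> E) p"
      unfolding read[OF p] read[OF q] .
  qed
  then show ?thesis by (simp add: class_poset_def n T_def D_def)
qed

end
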